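(* Let $\Lambda=\Lambda(\mathbb{F}_n)$ be the space of Schreier graphs of the free group $\mathbb{F}_n=\langle a_1,\ldots,a_n\rangle$. Then the spaces of invariant, unimodular, and conjugation-invariant probability measures on $\Lambda$ coincide: $\mathcal{I}(\Lambda)=\mathcal{U}(\Lambda)=\mathcal{C}(\Lambda)$.
   Context: A Schreier graph (of $\mathbb{F}_n$) is a connected rooted $2n$-regular graph $(\Gamma,x)$ (loops and multiple edges allowed, a loop contributing $2$ to the degree) whose edges are oriented and labeled with $a_1,\ldots,a_n$ so that every vertex has, for each $i$, precisely one incoming and one outgoing edge labeled $a_i$. Isomorphisms and automorphisms of Schreier graphs preserve edge labels and orientations. $\Lambda$ is the set of root-preserving isomorphism classes of Schreier graphs, equipped with the compact topology for which the cylinder sets $\{(\Gamma,x): U_r(x)\cong U\}$ form a base, where $U_r(x)$ is the $r$-neighborhood of the root $x$ (as a rooted labeled graph) and $U$ ranges over rooted labeled $r$-neighborhoods, $r\ge 0$. A subgroup $H\le\mathbb{F}_n$ corresponds to the Schreier graph with vertices the cosets $Hg$, root $H$, and an edge labeled $a_i$ directed from $Hg$ to $Hga_i$; this is a bijection between the lattice $L(\mathbb{F}_n)$ of subgroups of $\mathbb{F}_n$ and $\Lambda$. All measures are Borel probability measures. Conjugation-invariant measures: $\mathcal{C}(\Lambda)$ is the set of probability measures on $\Lambda\cong L(\mathbb{F}_n)$ invariant under the action $(g,H)\mapsto gHg^{-1}$ of $\mathbb{F}_n$ (on graphs, this action moves the root along the path labeled by a word). Invariant measures: let $\mathcal{E}\subset\Lambda\times\Lambda$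 be the equivalence relation with $(\Gamma,x)\sim(\Delta,y)$ iff $\Gamma$ and $\Delta$ are isomorphic as unrooted Schreier graphs. For a probability measure $\mu$ on $\Lambda$, the left counting measure on $\mathcal{E}$ is $\widetilde\mu_\ell(E)=\int |E\cap\pi_\ell^{-1}(\Gamma)|\,d\mu(\Gamma)$ and the right counting measure is $\widetilde\mu_r(E)=\int |E\cap\pi_r^{-1}(\Gamma)|\,d\mu(\Gamma)$, where $\pi_\ell,\pi_r:\mathcal{E}\to\Lambda$ are the projections onto the first and second coordinates. $\mu$ is invariant if $\widetilde\mu_\ell=\widetilde\mu_r$; $\mathcal{I}(\Lambda)$ is the set of such measures. Unimodular measures: let $\widetilde\Lambda$ be the space of isomorphism classes of doubly rooted Schreier graphs $(\Gamma,x,y)$ with principal root $x$ and secondary root $y$, with projections $\pi_x(\Gamma,x,y)=(\Gamma,x)$ and $\pi_y(\Gamma,x,y)=(\Gamma,y)$ to $\Lambda$. For a probability measure $\mu$ on $\Lambda$, $\widetilde\mu_x$ is the measure on $\widetilde\Lambda$ obtained by integrating against $\mu$ the measures on the fibers $\pi_x^{-1}(\Gamma,x)$ that assign to the class of $(\Gamma,x,y)$ the mass $|\mathrm{Aut}_x(\Gamma)\cdot y|$, the cardinality of the orbit of $y$ under the stabilizer $\mathrm{Aut}_x(\Gamma)$ of $x$ in $\mathrm{Aut}(\Gamma)$; $\widetilde\mu_y$ is defined analogously from $\pi_y$, the class of $(\Gamma,x,y)$ in the fiber over $(\Gamma,y)$ having mass $|\mathrm{Aut}_y(\Gamma)\cdot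 x|$. $\mu$ is unimodular if $\widetilde\mu_x=\widetilde\mu_y$; $\mathcal{U}(\Lambda)$ is the set of such measures. *)

theory Defs
  imports "HOL-Probability.Probability_Measure" "HOL-Algebra.Coset"
begin

section \<open>The free group of rank \<open>n\<close>\<close>

text \<open>Elements are reduced words; the letter \<open>(i, True)\<close> stands for the generator \<open>a\<^sub>i\<close>,
  the letter \<open>(i, False)\<close> for its inverse.\<close>

type_synonym letter = "nat \<times> bool"

definition letter_inv :: "letter \<Rightarrow> letter" where
  "letter_inv l = (fst l, \<not> snd l)"

definition reduced_word :: "letter list \<Rightarrow> bool" where
  "reduced_word w \<longleftrightarrow> (\<forall>k. Suc k < length w \<longrightarrow> w ! Suc k \<noteq> letter_inv (w ! k))"

fun push_letter :: "letter \<Rightarrow> letter list \<Rightarrow> letter list" where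
  "push_letter l [] = [l]"
| "push_letter l (m # w) = (if m = letter_inv l then w else l # m # w)"

definition free_group :: "nat \<Rightarrow> letter list monoid" where
  "free_group n =
     \<lparr>carrier = {w. reduced_word w \<and> set w \<subseteq> {1..n} \<times> UNIV},
      mult = foldr push_letter,
      one = []\<rparr>"

definition generator :: "nat \<Rightarrow> letter list" where
  "generator i = [(i, True)]"

section \<open>Schreier graphs\<close>

text \<open>An oriented edge from \<open>u\<close> to \<open>v\<close> with label \<open>a\<^sub>i\<close> is the triple \<open>(u, i, v)\<close>. Loops and multiple
  edges are allowed; a Schreier graph never has two parallel edges with the same orientation and the
  same label, since only one edge with a given label leaves a vertex.\<close>

record 'v lgraph =
  verts :: "'v set"
  edges :: "('v \<times> nat \<times> 'v) set"

definition adjacency :: "'v lgraph \<Rightarrow> 'v rel" where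
  "adjacency G = {(u, v). \<exists>i. (u, i, v) \<in> edges G \<or> (v, i, u) \<in> edges G}"

text \<open>The labeling condition forces the graph to be \<open>2n\<close>-regular (every vertex meets \<open>n\<close> incoming and
  \<open>n\<close> outgoing edges, a loop being counted once as either).\<close>

definition schreier_graph :: "nat \<Rightarrow> 'v lgraph \<Rightarrow> bool" where
  "schreier_graph n G \<longleftrightarrow>
     edges G \<subseteq> verts G \<times> {1..n} \<times> verts G \<and>
     (\<forall>u \<in> verts G. \<forall>v \<in> verts G. (u, v) \<in> (adjacency G)\<^sup>*) \<and>
     (\<forall>v \<in> verts G. \<forall>i \<in> {1..n}. (\<exists>!w. (v, i, w) \<in> edges G) \<and> (\<exists>!u. (u, i, v) \<in> edges G))"

definition lgraph_iso :: "('v \<Rightarrow> 'w) \<Rightarrow> 'v lgraph \<Rightarrow> 'w lgraph \<Rightarrow> bool" where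
  "lgraph_iso f G G' \<longleftrightarrow>
     bij_betw f (verts G) (verts G') \<and>
     (\<forall>u \<in> verts G. \<forall>v \<in> verts G. \<forall>i. (u, i, v) \<in> edges G \<longleftrightarrow> (f u, i, f v) \<in> edges G')"

definition isomorphic :: "'v lgraph \<Rightarrow> 'w lgraph \<Rightarrow> bool" where
  "isomorphic G G' \<longleftrightarrow> (\<exists>f. lgraph_iso f G G')"

definition rooted_isomorphic :: "'v lgraph \<times> 'v \<Rightarrow> 'w lgraph \<times> 'w \<Rightarrow> bool" where
  "rooted_isomorphic = (\<lambda>(G, x) (G', x'). \<exists>f. lgraph_iso f G G' \<and> f x = x')"

definition birooted_isomorphic :: "'v lgraph \<times> 'v \<times> 'v \<Rightarrow> 'w lgraph \<times> 'w \<times> 'w \<Rightarrow> bool" where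
  "birooted_isomorphic = (\<lambda>(G, x, y) (G', x', y'). \<exists>f. lgraph_iso f G G' \<and> f x = x' \<and> f y = y')"

text \<open>The \<open>r\<close>-neighborhood of \<open>x\<close>: the subgraph induced on the vertices at distance at most \<open>r\<close>
  from \<open>x\<close>.\<close>

definition ball_verts :: "'v lgraph \<Rightarrow> 'v \<Rightarrow> nat \<Rightarrow> 'v set" where
  "ball_verts G x r = {v \<in> verts G. \<exists>k \<le> r. (x, v) \<in> adjacency G ^^ k}"

definition nbhd :: "nat \<Rightarrow> 'v lgraph \<Rightarrow> 'v \<Rightarrow> 'v lgraph" where
  "nbhd r G x =
     \<lparr>verts = ball_verts G x r,
      edges = {(u, i, v) \<in> edges G. u \<in> ball_verts G x r \<and> v \<in> ball_verts G x r}\<rparr>"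

section \<open>The spaces of rooted and of doubly rooted Schreier graphs\<close>

text \<open>Schreier graphs are countable (connected and locally finite), so every isomorphism class is
  represented by a graph whose vertices are natural numbers.\<close>

definition rooted_schreier :: "nat \<Rightarrow> (nat lgraph \<times> nat) set" where
  "rooted_schreier n = {(G, x). schreier_graph n G \<and> x \<in> verts G}"

definition birooted_schreier :: "nat \<Rightarrow> (nat lgraph \<times> nat \<times> nat) set" where
  "birooted_schreier n = {(G, x, y). schreier_graph n G \<and> x \<in> verts G \<and> y \<in> verts G}"

type_synonym rooted_class = "(nat lgraph \<times> nat) set"
type_synonym birooted_class = "(nat lgraph \<times> nat \<times> nat) set"

definition Lambda :: "nat \<Rightarrow> rooted_class set" where
  "Lambda n = rooted_schreier n //
     {(p, q). p \<in> rooted_schreier n \<and> q \<in> rooted_schreier n \<and> rooted_isomorphic p q}"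

definition Lambda2 :: "nat \<Rightarrow> birooted_class set" where
  "Lambda2 n = birooted_schreier n //
     {(p, q). p \<in> birooted_schreier n \<and> q \<in> birooted_schreier n \<and> birooted_isomorphic p q}"

definition cylinder :: "nat \<Rightarrow> nat \<Rightarrow> nat lgraph \<times> nat \<Rightarrow> rooted_class set" where
  "cylinder n r = (\<lambda>(G0, x0).
     {c \<in> Lambda n. \<exists>(G, x) \<in> c. rooted_isomorphic (nbhd r G x, x) (nbhd r G0 x0, x0)})"

definition Lambda_top :: "nat \<Rightarrow> rooted_class topology" where
  "Lambda_top n = topology_generated_by {cylinder n r p | r p. p \<in> rooted_schreier n}"

text \<open>Cylinders for doubly rooted graphs: the \<open>r\<close>-neighborhood of the principal root is prescribed,
  for \<open>r\<close> large enough that it contains the secondary root.\<close>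

definition cylinder2 :: "nat \<Rightarrow> nat \<Rightarrow> nat lgraph \<times> nat \<times> nat \<Rightarrow> birooted_class set" where
  "cylinder2 n r = (\<lambda>(G0, x0, y0).
     {d \<in> Lambda2 n. \<exists>(G, x, y) \<in> d. y \<in> ball_verts G x r \<and>
        birooted_isomorphic (nbhd r G x, x, y) (nbhd r G0 x0, x0, y0)})"

definition Lambda2_top :: "nat \<Rightarrow> birooted_class topology" where
  "Lambda2_top n = topology_generated_by
     {cylinder2 n r (G, x, y) | r G x y.
        (G, x, y) \<in> birooted_schreier n \<and> y \<in> ball_verts G x r}"

definition borel_of :: "'a topology \<Rightarrow> 'a measure" where
  "borel_of X = sigma (topspace X) {U. openin X U}"

definition prob_measures :: "nat \<Rightarrow> rooted_class measure set" where
  "prob_measures n = {\<mu>. prob_space \<mu> \<and> sets \<mu> = sets (borel_of (Lambda_top n))}"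

text \<open>Possibly infinite cardinality.\<close>

definition ecard :: "'a set \<Rightarrow> ennreal" where
  "ecard S = emeasure (count_space UNIV) S"

section \<open>Conjugation-invariant measures\<close>

definition coset_graph :: "nat \<Rightarrow> letter list set \<Rightarrow> letter list set lgraph" where
  "coset_graph n H =
     \<lparr>verts = rcosets\<^bsub>free_group n\<^esub> H,
      edges = {(H #>\<^bsub>free_group n\<^esub> g, i, H #>\<^bsub>free_group n\<^esub> (g \<otimes>\<^bsub>free_group n\<^esub> generator i)) | g i.
                 g \<in> carrier (free_group n) \<and> i \<in> {1..n}}\<rparr>"

definition subgroups :: "nat \<Rightarrow> letter list set set" where
  "subgroups n = {H. subgroup H (free_group n)}"

text \<open>The bijection from subgroups to isomorphism classes of Schreier graphs.\<close>

definition schreier_class :: "nat \<Rightarrow> letter list set \<Rightarrow> rooted_class" where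
  "schreier_class n H = {p \<in> rooted_schreier n. rooted_isomorphic (coset_graph n H, H) p}"

definition conj_subgroup :: "nat \<Rightarrow> letter list \<Rightarrow> letter list set \<Rightarrow> letter list set" where
  "conj_subgroup n g H =
     (\<lambda>h. g \<otimes>\<^bsub>free_group n\<^esub> h \<otimes>\<^bsub>free_group n\<^esub> inv\<^bsub>free_group n\<^esub> g) ` H"

definition conj_act :: "nat \<Rightarrow> letter list \<Rightarrow> rooted_class \<Rightarrow> rooted_class" where
  "conj_act n g c = schreier_class n (conj_subgroup n g (inv_into (subgroups n) (schreier_class n) c))"

definition conjugation_invariant_measures :: "nat \<Rightarrow> rooted_class measure set" where
  "conjugation_invariant_measures n =
     {\<mu> \<in> prob_measures n. \<forall>g \<in> carrier (free_group n). \<forall>A \<in> sets \<mu>.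
        emeasure \<mu> (conj_act n g -` A \<inter> space \<mu>) = emeasure \<mu> A}"

section \<open>Invariant measures\<close>

definition equiv_rel :: "nat \<Rightarrow> rooted_class rel" where
  "equiv_rel n = {(c, d) \<in> Lambda n \<times> Lambda n. \<exists>(G, x) \<in> c. \<exists>(D, y) \<in> d. isomorphic G D}"

definition equiv_rel_borel :: "nat \<Rightarrow> (rooted_class \<times> rooted_class) measure" where
  "equiv_rel_borel n =
     borel_of (subtopology (prod_topology (Lambda_top n) (Lambda_top n)) (equiv_rel n))"

definition left_count :: "rooted_class measure \<Rightarrow> rooted_class rel \<Rightarrow> ennreal" where
  "left_count \<mu> A = (\<integral>\<^sup>+ c. ecard {p \<in> A. fst p = c} \<partial>\<mu>)"

definition right_count :: "rooted_class measure \<Rightarrow> rooted_class rel \<Rightarrow> ennreal" where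
  "right_count \<mu> A = (\<integral>\<^sup>+ c. ecard {p \<in> A. snd p = c} \<partial>\<mu>)"

definition invariant_measures :: "nat \<Rightarrow> rooted_class measure set" where
  "invariant_measures n =
     {\<mu> \<in> prob_measures n. \<forall>A \<in> sets (equiv_rel_borel n). left_count \<mu> A = right_count \<mu> A}"

section \<open>Unimodular measures\<close>

text \<open>Forgetting one root in all members of an isomorphism class of doubly rooted graphs yields a full
  isomorphism class of rooted graphs.\<close>

definition pi_x :: "birooted_class \<Rightarrow> rooted_class" where
  "pi_x d = (\<lambda>(G, x, y). (G, x)) ` d"

definition pi_y :: "birooted_class \<Rightarrow> rooted_class" where
  "pi_y d = (\<lambda>(G, x, y). (G, y)) ` d"

definition stab_orbit :: "'v lgraph \<Rightarrow> 'v \<Rightarrow> 'v \<Rightarrow> 'v set" where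
  "stab_orbit G x y = {f y | f. lgraph_iso f G G \<and> f x = x}"

text \<open>The orbit sizes do not depend on the representative of the class.\<close>

definition mass_x :: "birooted_class \<Rightarrow> ennreal" where
  "mass_x d = (case SOME t. t \<in> d of (G, x, y) \<Rightarrow> ecard (stab_orbit G x y))"

definition mass_y :: "birooted_class \<Rightarrow> ennreal" where
  "mass_y d = (case SOME t. t \<in> d of (G, x, y) \<Rightarrow> ecard (stab_orbit G y x))"

text \<open>The inner integrals against counting measure are sums over the fibers of the projections.\<close>

definition mu_x :: "rooted_class measure \<Rightarrow> birooted_class set \<Rightarrow> ennreal" where
  "mu_x \<mu> A = (\<integral>\<^sup>+ c. (\<integral>\<^sup>+ d. mass_x d \<partial>count_space {d \<in> A. pi_x d = c}) \<partial>\<mu>)"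

definition mu_y :: "rooted_class measure \<Rightarrow> birooted_class set \<Rightarrow> ennreal" where
  "mu_y \<mu> A = (\<integral>\<^sup>+ c. (\<integral>\<^sup>+ d. mass_y d \<partial>count_space {d \<in> A. pi_y d = c}) \<partial>\<mu>)"

definition unimodular_measures :: "nat \<Rightarrow> rooted_class measure set" where
  "unimodular_measures n =
     {\<mu> \<in> prob_measures n. \<forall>A \<in> sets (borel_of (Lambda2_top n)). mu_x \<mu> A = mu_y \<mu> A}"

end

theory Submission
  imports Defs
begin

text \<open>All three conditions on a measure \<open>\<mu>\<close> turn out to say that \<open>\<mu>\<close> is preserved by each of the
  maps that move the root of a Schreier graph along a fixed group element.

  For conjugation invariance this is the identity \<open>conj_act n g = move_root (g\<inverse>)\<close>. A rooted
  Schreier graph \<open>(G, x)\<close> is the coset graph of the stabilizer of \<open>x\<close>, the group of words that lead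
  from \<open>x\<close> back to \<open>x\<close>, and the stabilizer of the endpoint of the path labelled \<open>g\<inverse>\<close> is the conjugate
  by \<open>g\<close> of the stabilizer of \<open>x\<close> (lemma \<open>conj_act_eq_move_root\<close>).

  The two counting conditions are instances of one statement, in the spirit of Feldman and Moore.
  Let a space \<open>N\<close> be covered by countably many measurable pieces, the piece with index \<open>g\<close> being the
  graph of a bimeasurable bijection \<open>T\<^sub>g\<close> of \<open>\<Lambda>\<close>: one projection \<open>p\<close> of \<open>N\<close> restricts to a bijection
  of the piece with \<open>\<Lambda>\<close>, and the other projection \<open>q\<close> is \<open>T\<^sub>g \<circ> p\<close> on it. Then counting along the
  fibres of \<open>p\<close> and along the fibres of \<open>q\<close> gives the same measure on \<open>N\<close> iff every \<open>T\<^sub>g\<close> preserves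
  \<open>\<mu>\<close>. Testing on subsets of a single piece gives invariance under \<open>T\<^sub>g\<close>; conversely a measurable
  set is cut into disjoint parts, each inside one piece, where both counts are indicator functions
  (lemma \<open>counts_eq_iff_invariant\<close>).

  Since Schreier graphs are connected, this applies to the equivalence relation, with the pieces
  \<open>{(c, move_root g c)}\<close>, and to the doubly rooted graphs, with the pieces \<open>{(G, x, y). y = x g}\<close>.
  The two spaces differ, as two pairs \<open>(x, y)\<close>, \<open>(x, y')\<close> related by an automorphism of the unrooted
  graph are distinct doubly rooted graphs over the same pair of classes, but the argument does not
  see the difference.
  The orbit weights in the definition of unimodularity are all \<open>1\<close>: an automorphism of a connected
  graph that respects labels and fixes the root fixes everything (lemma \<open>stab_orbit_trivial\<close>).

  It remains to see that the pieces and the maps are measurable. The \<open>r\<close>-neighbourhood of a root and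
  the set of short words that lead from the root back to itself determine each other, up to a
  change of the length (lemmas \<open>lgraph_iso_nbhd_if_same_loops\<close> and
  \<open>same_loops_if_rooted_isomorphic_nbhd\<close>). So openness can be tested on closed words, where moving
  the root along \<open>w\<close> only replaces the word \<open>v\<close> by its conjugate \<open>w v w\<inverse>\<close>.\<close>

section \<open>The free group acts on itself by pushing letters\<close>

definition letters :: "nat \<Rightarrow> letter set" where
  "letters n = {1..n} \<times> UNIV"

definition inv_word :: "letter list \<Rightarrow> letter list" where
  "inv_word w = rev (map letter_inv w)"

lemma letter_inv_inv [simp]: "letter_inv (letter_inv l) = l"
  by (simp add: letter_inv_def)

lemma letter_inv_letters [simp]: "letter_inv l \<in> letters n \<longleftrightarrow> l \<in> letters n"
  by (auto simp: letter_inv_def letters_def mem_Times_iff)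

lemma inv_word_simps [simp]:
  "inv_word [] = []" "inv_word (l # w) = inv_word w @ [letter_inv l]"
  "inv_word (v @ w) = inv_word w @ inv_word v" "inv_word (inv_word w) = w"
  "length (inv_word w) = length w"
  by (simp_all add: inv_word_def rev_map o_def)

lemma inv_word_letters [simp]: "set (inv_word w) \<subseteq> letters n \<longleftrightarrow> set w \<subseteq> letters n"
  by (induction w) auto

lemma reduced_word_Nil [simp]: "reduced_word []"
  by (simp add: reduced_word_def)

lemma reduced_word_Cons:
  "reduced_word (l # w) \<longleftrightarrow> reduced_word w \<and> (w = [] \<or> hd w \<noteq> letter_inv l)"
proof (cases w)
  case (Cons m v)
  then show ?thesis
    unfolding reduced_word_def by (auto simp: nth_Cons' less_Suc_eq_0_disj)
qed (simp add: reduced_word_def)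

lemma reduced_push_letter: "reduced_word w \<Longrightarrow> reduced_word (push_letter l w)"
  by (cases w) (auto simp: reduced_word_Cons)

lemma push_letter_reduced: "reduced_word (l # w) \<Longrightarrow> push_letter l w = l # w"
  by (cases w) (auto simp: reduced_word_Cons)

lemma push_letter_cancel:
  "reduced_word w \<Longrightarrow> push_letter (letter_inv l) (push_letter l w) = w"
  by (cases w) (auto simp: reduced_word_Cons push_letter_reduced)

lemma push_letter_cancel':
  "reduced_word w \<Longrightarrow> push_letter l (push_letter (letter_inv l) w) = w"
  using push_letter_cancel[of w "letter_inv l"] by simp

lemma set_push_letter: "set (push_letter l w) \<subseteq> insert l (set w)"
  by (cases w) auto

lemma reduced_foldr_push: "reduced_word w \<Longrightarrow> reduced_word (foldr push_letter u w)"
  by (induction u) (auto intro: reduced_push_letter)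

lemma set_foldr_push: "set (foldr push_letter u w) \<subseteq> set u \<union> set w"
  using set_push_letter by (induction u) fastforce+

text \<open>The product of reduced words is the action of the first word on the second one, letter by
  letter. Associativity is therefore the statement that this is an action, and by induction it is
  enough to see that a cancelled pair of letters acts trivially.\<close>

lemma foldr_push_push_letter:
  assumes "reduced_word w"
  shows "foldr push_letter (push_letter l u) w = push_letter l (foldr push_letter u w)"
  by (cases u) (auto simp: push_letter_cancel' reduced_foldr_push assms)

lemma foldr_push_assoc:
  assumes "reduced_word w"
  shows "foldr push_letter (foldr push_letter u v) w = foldr push_letter u (foldr push_letter v w)"
  by (induction u) (auto simp: foldr_push_push_letter assms)

lemma foldr_push_reduced: "reduced_word (u @ w) \<Longrightarrow> foldr push_letter u w = u @ w"
  by (induction u) (auto simp: reduced_word_Cons push_letter_reduced)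

lemma foldr_push_inv_word:
  "reduced_word w \<Longrightarrow> foldr push_letter (inv_word u) (foldr push_letter u w) = w"
  by (induction u arbitrary: w) (auto simp: push_letter_cancel reduced_foldr_push)

lemma carrier_free_group:
  "g \<in> carrier (free_group n) \<longleftrightarrow> reduced_word g \<and> set g \<subseteq> letters n"
  by (simp add: free_group_def letters_def)

lemma mult_free_group [simp]: "mult (free_group n) = foldr push_letter"
  by (simp add: free_group_def)

lemma one_free_group [simp]: "one (free_group n) = []"
  by (simp add: free_group_def)

lemma foldr_push_carrier:
  "set u \<subseteq> letters n \<Longrightarrow> w \<in> carrier (free_group n) \<Longrightarrow>
    foldr push_letter u w \<in> carrier (free_group n)"
  using set_foldr_push[of u w] by (auto simp: carrier_free_group reduced_foldr_push)

lemma Nil_carrier [simp]: "[] \<in> carrier (free_group n)"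
  by (simp add: carrier_free_group)

lemma left_inverse_free_group:
  assumes "g \<in> carrier (free_group n)"
  shows "foldr push_letter (inv_word g) [] \<in> carrier (free_group n)"
    and "foldr push_letter (foldr push_letter (inv_word g) []) g = []"
proof -
  show "foldr push_letter (inv_word g) [] \<in> carrier (free_group n)"
    using assms by (intro foldr_push_carrier) (auto simp: carrier_free_group)
  have "foldr push_letter (foldr push_letter (inv_word g) []) g = foldr push_letter (inv_word g) g"
    using assms by (simp add: foldr_push_assoc carrier_free_group)
  also have "\<dots> = []"
    using foldr_push_inv_word[of "[]" g] foldr_push_reduced[of g "[]"] assms
    by (simp add: carrier_free_group)
  finally show "foldr push_letter (foldr push_letter (inv_word g) []) g = []" .
qed

lemma group_free_group: "group (free_group n)"
proof (rule groupI)
  fix x y z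
  assume "x \<in> carrier (free_group n)" "y \<in> carrier (free_group n)" "z \<in> carrier (free_group n)"
  then show "x \<otimes>\<^bsub>free_group n\<^esub> y \<in> carrier (free_group n)"
    and "x \<otimes>\<^bsub>free_group n\<^esub> y \<otimes>\<^bsub>free_group n\<^esub> z = x \<otimes>\<^bsub>free_group n\<^esub> (y \<otimes>\<^bsub>free_group n\<^esub> z)"
    using foldr_push_carrier[of x n y] by (simp_all add: foldr_push_assoc carrier_free_group)
next
  fix x assume "x \<in> carrier (free_group n)"
  then show "\<exists>y\<in>carrier (free_group n). y \<otimes>\<^bsub>free_group n\<^esub> x = \<one>\<^bsub>free_group n\<^esub>"
    using left_inverse_free_group[of x n]
    by (intro bexI[of _ "foldr push_letter (inv_word x) []"]) auto
qed simp_all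

lemma countable_free_group: "countable (carrier (free_group n))"
  by simp

section \<open>Walking along words in a Schreier graph\<close>

text \<open>An inverse letter traverses an edge against its orientation.\<close>

definition letter_edge :: "'v lgraph \<Rightarrow> 'v \<Rightarrow> letter \<Rightarrow> 'v \<Rightarrow> bool" where
  "letter_edge G u l v \<longleftrightarrow> (if snd l then (u, fst l, v) \<in> edges G else (v, fst l, u) \<in> edges G)"

definition walk_step :: "'v lgraph \<Rightarrow> 'v \<Rightarrow> letter \<Rightarrow> 'v" where
  "walk_step G u l = (THE v. letter_edge G u l v)"

definition walk :: "'v lgraph \<Rightarrow> 'v \<Rightarrow> letter list \<Rightarrow> 'v" where
  "walk G = foldl (walk_step G)"

lemma walk_simps [simp]:
  "walk G u [] = u" "walk G u (l # w) = walk G (walk_step G u l) w"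
  "walk G u (v @ w) = walk G (walk G u v) w"
  by (simp_all add: walk_def)

lemma letter_edge_inv [simp]: "letter_edge G u (letter_inv l) v \<longleftrightarrow> letter_edge G v l u"
  by (simp add: letter_edge_def letter_inv_def)

lemma adjacency_iff_letter_edge:
  assumes "schreier_graph n G"
  shows "(u, v) \<in> adjacency G \<longleftrightarrow> (\<exists>l\<in>letters n. letter_edge G u l v)"
  using assms unfolding adjacency_def letter_edge_def schreier_graph_def letters_def
  by (auto split: if_splits)

lemma letter_edge_verts:
  assumes "schreier_graph n G" "letter_edge G u l v"
  shows "u \<in> verts G" "v \<in> verts G" "l \<in> letters n"
  using assms unfolding letter_edge_def schreier_graph_def letters_def
  by (auto simp: mem_Times_iff split: if_splits)

lemma letter_edge_ex1:
  assumes "schreier_graph n G" "u \<in> verts G" "l \<in> letters n"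
  shows "\<exists>!v. letter_edge G u l v"
proof -
  have "fst l \<in> {1..n}"
    using assms(3) by (auto simp: letters_def)
  then have "(\<exists>!v. (u, fst l, v) \<in> edges G) \<and> (\<exists>!v. (v, fst l, u) \<in> edges G)"
    using assms(1,2) unfolding schreier_graph_def by blast
  then show ?thesis
    unfolding letter_edge_def by (cases "snd l") simp_all
qed

lemma walk_step_iff:
  assumes "schreier_graph n G" "u \<in> verts G" "l \<in> letters n"
  shows "walk_step G u l = v \<longleftrightarrow> letter_edge G u l v"
  using theI'[OF letter_edge_ex1[OF assms]] letter_edge_ex1[OF assms]
  unfolding walk_step_def by blast

lemma walk_step_verts:
  assumes "schreier_graph n G" "u \<in> verts G" "l \<in> letters n"
  shows "walk_step G u l \<in> verts G"
  using walk_step_iff[OF assms] letter_edge_verts[OF assms(1)] by blast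

lemma walk_step_inv:
  assumes "schreier_graph n G" "u \<in> verts G" "l \<in> letters n"
  shows "walk_step G (walk_step G u l) (letter_inv l) = u"
  using assms by (simp add: walk_step_iff[of n] walk_step_verts[of n] flip: walk_step_iff[OF assms])

lemma walk_verts:
  assumes "schreier_graph n G" "u \<in> verts G" "set w \<subseteq> letters n"
  shows "walk G u w \<in> verts G"
  using assms(2,3) by (induction w arbitrary: u) (auto simp: walk_step_verts[OF assms(1)])

lemma walk_inv_word:
  assumes "schreier_graph n G" "u \<in> verts G" "set w \<subseteq> letters n"
  shows "walk G (walk G u w) (inv_word w) = u"
  using assms(2,3)
  by (induction w arbitrary: u) (auto simp: walk_step_verts[OF assms(1)] walk_step_inv[OF assms(1)])

lemma walk_inv_word':
  assumes "schreier_graph n G" "u \<in> verts G" "set w \<subseteq> letters n"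
  shows "walk G (walk G u (inv_word w)) w = u"
  using walk_inv_word[of n G u "inv_word w"] assms by simp

lemma walk_eq_iff:
  assumes "schreier_graph n G" "u \<in> verts G" "set v \<subseteq> letters n" "set w \<subseteq> letters n"
  shows "walk G u v = walk G u w \<longleftrightarrow> walk G u (v @ inv_word w) = u"
  using walk_inv_word[OF assms(1,2,4)] walk_inv_word'[OF assms(1) walk_verts[OF assms(1,2,3)] assms(4)]
  by auto

text \<open>Walking does not see the cancellation of a letter with its inverse, so that words act on the
  vertices through the free group.\<close>

lemma walk_push_letter:
  assumes "schreier_graph n G" "u \<in> verts G" "l \<in> letters n" "set w \<subseteq> letters n"
  shows "walk G u (push_letter l w) = walk G u (l # w)"
  using assms by (cases w) (auto simp: walk_step_inv)

lemma walk_foldr_push: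
  assumes "schreier_graph n G" "u \<in> verts G" "set v \<subseteq> letters n" "set w \<subseteq> letters n"
  shows "walk G u (foldr push_letter v w) = walk G u (v @ w)"
  using assms(2,3)
proof (induction v arbitrary: u)
  case (Cons l v)
  have "set (foldr push_letter v w) \<subseteq> letters n"
    using set_foldr_push[of v w] Cons.prems assms(4) by auto
  then show ?case
    using Cons assms(1) by (simp add: walk_push_letter walk_step_verts)
qed simp

lemma walk_mult:
  assumes "schreier_graph n G" "u \<in> verts G" "g \<in> carrier (free_group n)" "h \<in> carrier (free_group n)"
  shows "walk G u (g \<otimes>\<^bsub>free_group n\<^esub> h) = walk G (walk G u g) h"
  using assms by (simp add: walk_foldr_push carrier_free_group)

lemma walk_carrier_verts:
  assumes "schreier_graph n G" "u \<in> verts G" "g \<in> carrier (free_group n)"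
  shows "walk G u g \<in> verts G"
  using assms by (simp add: walk_verts carrier_free_group)

lemma walk_inv:
  assumes "schreier_graph n G" "u \<in> verts G" "g \<in> carrier (free_group n)"
  shows "walk G (walk G u g) (inv\<^bsub>free_group n\<^esub> g) = u"
    and "walk G (walk G u (inv\<^bsub>free_group n\<^esub> g)) g = u"
proof -
  interpret group "free_group n" by (rule group_free_group)
  show "walk G (walk G u g) (inv\<^bsub>free_group n\<^esub> g) = u"
    using walk_mult[OF assms inv_closed[OF assms(3)]] assms(3) r_inv[OF assms(3)]
    by (simp del: mult_free_group)
  show "walk G (walk G u (inv\<^bsub>free_group n\<^esub> g)) g = u"
    using walk_mult[OF assms(1,2) inv_closed[OF assms(3)] assms(3)] l_inv[OF assms(3)]
    by (simp del: mult_free_group)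
qed

lemma singleton_carrier: "l \<in> letters n \<Longrightarrow> [l] \<in> carrier (free_group n)"
  by (simp add: carrier_free_group reduced_word_Cons)

text \<open>A path in the graph spells a word; its reduced form has the same endpoint.\<close>

lemma schreier_connected:
  assumes "schreier_graph n G" "u \<in> verts G" "v \<in> verts G"
  obtains g where "g \<in> carrier (free_group n)" "walk G u g = v"
proof -
  have "(u, v) \<in> (adjacency G)\<^sup>*"
    using assms unfolding schreier_graph_def by blast
  then have "\<exists>w. set w \<subseteq> letters n \<and> walk G u w = v"
  proof (induction rule: rtrancl_induct)
    case base
    show ?case by (rule exI[of _ "[]"]) simp
  next
    case (step y z)
    then obtain w where w: "set w \<subseteq> letters n" "walk G u w = y" by auto
    obtain l where l: "l \<in> letters n" "letter_edge G y l z"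
      using step.hyps(2) adjacency_iff_letter_edge[OF assms(1)] by blast
    then have "walk_step G y l = z"
      using letter_edge_verts[OF assms(1)] walk_step_iff[OF assms(1)] by blast
    then show ?case
      using w l by (intro exI[of _ "w @ [l]"]) simp
  qed
  then obtain w where w: "set w \<subseteq> letters n" "walk G u w = v" by blast
  show thesis
  proof (rule that)
    show "foldr push_letter w [] \<in> carrier (free_group n)"
      using w by (simp add: foldr_push_carrier)
    show "walk G u (foldr push_letter w []) = v"
      using w assms by (simp add: walk_foldr_push)
  qed
qed

section \<open>Isomorphisms\<close>

lemma lgraph_iso_id: "lgraph_iso id G G"
  by (simp add: lgraph_iso_def)

lemma lgraph_iso_inv:
  assumes "lgraph_iso f G G'"
  shows "lgraph_iso (inv_into (verts G) f) G' G"
proof -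
  have f: "bij_betw f (verts G) (verts G')"
    using assms by (simp add: lgraph_iso_def)
  have "inv_into (verts G) f u \<in> verts G" "f (inv_into (verts G) f u) = u" if "u \<in> verts G'" for u
    using that f bij_betw_inv_into_right[OF f] by (auto simp: bij_betw_def inv_into_into)
  then show ?thesis
    using assms bij_betw_inv_into[OF f] unfolding lgraph_iso_def by force
qed

lemma lgraph_iso_comp:
  assumes "lgraph_iso f G G'" "lgraph_iso g G' G''"
  shows "lgraph_iso (g \<circ> f) G G''"
  using assms unfolding lgraph_iso_def by (auto intro: bij_betw_trans simp: bij_betw_apply)

lemma lgraph_iso_verts: "lgraph_iso f G G' \<Longrightarrow> u \<in> verts G \<Longrightarrow> f u \<in> verts G'"
  by (auto simp: lgraph_iso_def bij_betw_apply)

lemma lgraph_iso_inj: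
  "lgraph_iso f G G' \<Longrightarrow> u \<in> verts G \<Longrightarrow> v \<in> verts G \<Longrightarrow> f u = f v \<longleftrightarrow> u = v"
  by (auto simp: lgraph_iso_def bij_betw_def inj_on_def)

lemma lgraph_iso_letter_edge:
  "lgraph_iso f G G' \<Longrightarrow> u \<in> verts G \<Longrightarrow> v \<in> verts G \<Longrightarrow>
    letter_edge G' (f u) l (f v) \<longleftrightarrow> letter_edge G u l v"
  by (auto simp: lgraph_iso_def letter_edge_def)

lemma lgraph_iso_walk:
  assumes "schreier_graph n G" "schreier_graph n G'" "lgraph_iso f G G'"
    and "u \<in> verts G" "set w \<subseteq> letters n"
  shows "f (walk G u w) = walk G' (f u) w"
  using assms(4,5)
proof (induction w arbitrary: u)
  case (Cons l w)
  have u: "walk_step G u l \<in> verts G" "f u \<in> verts G'" "l \<in> letters n"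
    using Cons.prems assms by (auto simp: walk_step_verts lgraph_iso_verts)
  have "letter_edge G u l (walk_step G u l)"
    using walk_step_iff[OF assms(1)] Cons.prems u by blast
  then have "walk_step G' (f u) l = f (walk_step G u l)"
    using walk_step_iff[OF assms(2)] Cons.prems u lgraph_iso_letter_edge[OF assms(3)] by blast
  then show ?case
    using Cons u by simp
qed simp

lemma birooted_isomorphic_refl: "birooted_isomorphic (G, x, y) (G, x, y)"
  using lgraph_iso_id[of G] by (auto simp: birooted_isomorphic_def)

lemma birooted_isomorphic_sym:
  assumes "birooted_isomorphic (G, x, y) (G', x', y')" "x \<in> verts G" "y \<in> verts G"
  shows "birooted_isomorphic (G', x', y') (G, x, y)"
proof -
  obtain f where f: "lgraph_iso f G G'" "f x = x'" "f y = y'"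
    using assms by (auto simp: birooted_isomorphic_def)
  have "inj_on f (verts G)"
    using f by (auto simp: lgraph_iso_def bij_betw_def)
  then show ?thesis
    using lgraph_iso_inv[OF f(1)] f(2,3) assms(2,3)
    by (auto simp: birooted_isomorphic_def intro!: exI[of _ "inv_into (verts G) f"])
qed

lemma birooted_isomorphic_trans:
  assumes "birooted_isomorphic (G, x, y) (G', x', y')" "birooted_isomorphic (G', x', y') (G'', x'', y'')"
  shows "birooted_isomorphic (G, x, y) (G'', x'', y'')"
proof -
  obtain f g where "lgraph_iso f G G'" "f x = x'" "f y = y'" "lgraph_iso g G' G''" "g x' = x''" "g y' = y''"
    using assms by (auto simp: birooted_isomorphic_def)
  then show ?thesis
    using lgraph_iso_comp[of f G G' g G''] by (auto simp: birooted_isomorphic_def intro!: exI[of _ "g \<circ> f"])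
qed

lemma rooted_iff_birooted:
  "rooted_isomorphic (G, x) (G', x') \<longleftrightarrow> birooted_isomorphic (G, x, x) (G', x', x')"
  by (simp add: rooted_isomorphic_def birooted_isomorphic_def)

lemma rooted_isomorphic_refl: "rooted_isomorphic (G, x) (G, x)"
  by (simp add: rooted_iff_birooted birooted_isomorphic_refl)

lemma rooted_isomorphic_sym:
  "rooted_isomorphic (G, x) (G', x') \<Longrightarrow> x \<in> verts G \<Longrightarrow> rooted_isomorphic (G', x') (G, x)"
  unfolding rooted_iff_birooted by (rule birooted_isomorphic_sym)

lemma rooted_isomorphic_trans:
  "rooted_isomorphic (G, x) (G', x') \<Longrightarrow> rooted_isomorphic (G', x') (G'', x'') \<Longrightarrow>
    rooted_isomorphic (G, x) (G'', x'')"
  unfolding rooted_iff_birooted by (rule birooted_isomorphic_trans)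

section \<open>Isomorphism classes\<close>

definition rclass :: "nat \<Rightarrow> nat lgraph \<times> nat \<Rightarrow> rooted_class" where
  "rclass n p = {q \<in> rooted_schreier n. rooted_isomorphic p q}"

definition bclass :: "nat \<Rightarrow> nat lgraph \<times> nat \<times> nat \<Rightarrow> birooted_class" where
  "bclass n p = {q \<in> birooted_schreier n. birooted_isomorphic p q}"

lemma rooted_schreier_iff [simp]: "(G, x) \<in> rooted_schreier n \<longleftrightarrow> schreier_graph n G \<and> x \<in> verts G"
  by (simp add: rooted_schreier_def)

lemma birooted_schreier_iff [simp]:
  "(G, x, y) \<in> birooted_schreier n \<longleftrightarrow> schreier_graph n G \<and> x \<in> verts G \<and> y \<in> verts G"
  by (simp add: birooted_schreier_def)

lemma Lambda_eq: "Lambda n = rclass n ` rooted_schreier n"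
  by (auto simp: Lambda_def quotient_def rclass_def)

lemma Lambda2_eq: "Lambda2 n = bclass n ` birooted_schreier n"
  by (auto simp: Lambda2_def quotient_def bclass_def)

lemma LambdaE:
  assumes "c \<in> Lambda n"
  obtains G x where "schreier_graph n G" "x \<in> verts G" "c = rclass n (G, x)"
  using assms by (auto simp: Lambda_eq)

lemma Lambda2E:
  assumes "d \<in> Lambda2 n"
  obtains G x y where "schreier_graph n G" "x \<in> verts G" "y \<in> verts G" "d = bclass n (G, x, y)"
  using assms by (auto simp: Lambda2_eq)

lemma rclass_in_Lambda [simp]:
  "schreier_graph n G \<Longrightarrow> x \<in> verts G \<Longrightarrow> rclass n (G, x) \<in> Lambda n"
  by (auto simp: Lambda_eq)

lemma bclass_in_Lambda2 [simp]:
  "schreier_graph n G \<Longrightarrow> x \<in> verts G \<Longrightarrow> y \<in> verts G \<Longrightarrow> bclass n (G, x, y) \<in> Lambda2 n"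
  by (auto simp: Lambda2_eq)

lemma mem_rclass:
  "(G', x') \<in> rclass n (G, x) \<longleftrightarrow>
    schreier_graph n G' \<and> x' \<in> verts G' \<and> rooted_isomorphic (G, x) (G', x')"
  by (auto simp: rclass_def)

lemma mem_bclass:
  "(G', x', y') \<in> bclass n (G, x, y) \<longleftrightarrow>
    schreier_graph n G' \<and> x' \<in> verts G' \<and> y' \<in> verts G' \<and> birooted_isomorphic (G, x, y) (G', x', y')"
  by (auto simp: bclass_def)

lemma rclass_eq_iff:
  assumes "schreier_graph n G" "x \<in> verts G" "schreier_graph n G'" "x' \<in> verts G'"
  shows "rclass n (G, x) = rclass n (G', x') \<longleftrightarrow> rooted_isomorphic (G, x) (G', x')"
proof
  assume "rclass n (G, x) = rclass n (G', x')"
  then have "(G', x') \<in> rclass n (G, x)"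
    using assms by (simp add: mem_rclass rooted_isomorphic_refl)
  then show "rooted_isomorphic (G, x) (G', x')"
    by (simp add: mem_rclass)
next
  assume *: "rooted_isomorphic (G, x) (G', x')"
  show "rclass n (G, x) = rclass n (G', x')"
    using rooted_isomorphic_trans[OF *] rooted_isomorphic_trans[OF rooted_isomorphic_sym[OF * assms(2)]]
    by (auto simp: mem_rclass)
qed

lemma bclass_eq_iff:
  assumes "schreier_graph n G" "x \<in> verts G" "y \<in> verts G"
    "schreier_graph n G'" "x' \<in> verts G'" "y' \<in> verts G'"
  shows "bclass n (G, x, y) = bclass n (G', x', y') \<longleftrightarrow> birooted_isomorphic (G, x, y) (G', x', y')"
proof
  assume "bclass n (G, x, y) = bclass n (G', x', y')"
  then have "(G', x', y') \<in> bclass n (G, x, y)"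
    using assms by (simp add: mem_bclass birooted_isomorphic_refl)
  then show "birooted_isomorphic (G, x, y) (G', x', y')"
    by (simp add: mem_bclass)
next
  assume *: "birooted_isomorphic (G, x, y) (G', x', y')"
  show "bclass n (G, x, y) = bclass n (G', x', y')"
    using birooted_isomorphic_trans[OF *]
      birooted_isomorphic_trans[OF birooted_isomorphic_sym[OF * assms(2,3)]]
    by (auto simp: mem_bclass)
qed

lemma rclass_of_member:
  assumes "c \<in> Lambda n" "(G, x) \<in> c"
  shows "schreier_graph n G" "x \<in> verts G" "c = rclass n (G, x)"
proof -
  obtain G' x' where c: "schreier_graph n G'" "x' \<in> verts G'" "c = rclass n (G', x')"
    using assms(1) by (rule LambdaE)
  with assms(2) show "schreier_graph n G" "x \<in> verts G" and "c = rclass n (G, x)"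
    by (simp_all add: mem_rclass rclass_eq_iff)
qed

lemma bclass_of_member:
  assumes "d \<in> Lambda2 n" "(G, x, y) \<in> d"
  shows "schreier_graph n G" "x \<in> verts G" "y \<in> verts G" "d = bclass n (G, x, y)"
proof -
  obtain G' x' y' where d: "schreier_graph n G'" "x' \<in> verts G'" "y' \<in> verts G'"
      "d = bclass n (G', x', y')"
    using assms(1) by (rule Lambda2E)
  with assms(2) show "schreier_graph n G" "x \<in> verts G" "y \<in> verts G" and "d = bclass n (G, x, y)"
    by (simp_all add: mem_bclass bclass_eq_iff)
qed

section \<open>Moving the root, and the conjugation action\<close>

definition move_root :: "letter list \<Rightarrow> rooted_class \<Rightarrow> rooted_class" where
  "move_root w c = (\<lambda>(G, x). (G, walk G x w)) ` c"

lemma move_root_rclass: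
  assumes G: "schreier_graph n G" "x \<in> verts G" and w: "set w \<subseteq> letters n"
  shows "move_root w (rclass n (G, x)) = rclass n (G, walk G x w)"
proof (intro equalityI subrelI)
  fix G' z
  assume "(G', z) \<in> move_root w (rclass n (G, x))"
  then obtain x' where x': "schreier_graph n G'" "x' \<in> verts G'" "rooted_isomorphic (G, x) (G', x')"
    "z = walk G' x' w"
    by (auto simp: move_root_def mem_rclass)
  then obtain f where "lgraph_iso f G G'" "f x = x'"
    by (auto simp: rooted_isomorphic_def)
  then show "(G', z) \<in> rclass n (G, walk G x w)"
    using x' G w lgraph_iso_walk[of n G G' f x w]
    by (auto simp: mem_rclass walk_verts rooted_isomorphic_def)
next
  fix G' z
  assume "(G', z) \<in> rclass n (G, walk G x w)"
  then obtain f where z: "schreier_graph n G'" "z \<in> verts G'" "lgraph_iso f G G'" "f (walk G x w) = z"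
    by (auto simp: mem_rclass rooted_isomorphic_def)
  then have "(G', f x) \<in> rclass n (G, x)" "z = walk G' (f x) w"
    using G w lgraph_iso_walk[of n G G' f x w]
    by (auto simp: mem_rclass lgraph_iso_verts rooted_isomorphic_def)
  then show "(G', z) \<in> move_root w (rclass n (G, x))"
    by (force simp: move_root_def)
qed

lemma move_root_Lambda:
  assumes "c \<in> Lambda n" "set w \<subseteq> letters n"
  shows "move_root w c \<in> Lambda n"
  using assms by (auto elim!: LambdaE simp: move_root_rclass walk_verts)

lemma move_root_inv:
  assumes "c \<in> Lambda n" "g \<in> carrier (free_group n)"
  shows "move_root (inv\<^bsub>free_group n\<^esub> g) (move_root g c) = c"
    and "move_root g (move_root (inv\<^bsub>free_group n\<^esub> g) c) = c"
proof -
  have "inv\<^bsub>free_group n\<^esub> g \<in> carrier (free_group n)"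
    using assms by (simp add: group.inv_closed group_free_group)
  then show "move_root (inv\<^bsub>free_group n\<^esub> g) (move_root g c) = c"
    and "move_root g (move_root (inv\<^bsub>free_group n\<^esub> g) c) = c"
    using assms
    by (auto elim!: LambdaE simp: move_root_rclass walk_carrier_verts walk_inv
        carrier_free_group[THEN iffD1, THEN conjunct2])
qed

text \<open>Under the correspondence between Schreier graphs and subgroups, this is the subgroup that
  belongs to \<open>(G, x)\<close>.\<close>

definition stabilizer :: "nat \<Rightarrow> 'v lgraph \<Rightarrow> 'v \<Rightarrow> letter list set" where
  "stabilizer n G x = {g \<in> carrier (free_group n). walk G x g = x}"

lemma subgroup_stabilizer:
  assumes "schreier_graph n G" "x \<in> verts G"
  shows "subgroup (stabilizer n G x) (free_group n)"
proof -
  interpret group "free_group n" by (rule group_free_group)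
  show ?thesis
  proof (rule subgroupI)
    show "stabilizer n G x \<noteq> {}"
      using Nil_carrier[of n] by (fastforce simp: stabilizer_def)
  next
    fix g assume g: "g \<in> stabilizer n G x"
    then show "inv\<^bsub>free_group n\<^esub> g \<in> stabilizer n G x"
      using walk_inv(1)[OF assms, of g] by (simp add: stabilizer_def)
    fix h assume "h \<in> stabilizer n G x"
    then show "g \<otimes>\<^bsub>free_group n\<^esub> h \<in> stabilizer n G x"
      using walk_mult[OF assms, of g h] g m_closed[of g h] 
      by (simp add: stabilizer_def del: mult_free_group)
  qed (simp add: stabilizer_def)
qed

text \<open>The vertices are the cosets of the stabilizer: \<open>x h = x g\<close> iff \<open>h g\<inverse>\<close> fixes \<open>x\<close>.\<close>

lemma stabilizer_coset:
  assumes "schreier_graph n G" "x \<in> verts G" "g \<in> carrier (free_group n)"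
  shows "stabilizer n G x #>\<^bsub>free_group n\<^esub> g = {h \<in> carrier (free_group n). walk G x h = walk G x g}"
    (is "?L = ?R")
proof -
  interpret group "free_group n" by (rule group_free_group)
  show ?thesis
  proof (intro equalityI subsetI)
    fix k assume "k \<in> ?L"
    then obtain h where h: "h \<in> carrier (free_group n)" "walk G x h = x" "k = h \<otimes>\<^bsub>free_group n\<^esub> g"
      by (auto simp: r_coset_def stabilizer_def)
    then show "k \<in> ?R"
      using walk_mult[OF assms(1,2) h(1) assms(3)] m_closed[OF h(1) assms(3)]
      by (simp del: mult_free_group)
  next
    fix k assume k: "k \<in> ?R"
    then have "k \<otimes>\<^bsub>free_group n\<^esub> inv\<^bsub>free_group n\<^esub> g \<in> stabilizer n G x"
      using walk_mult[OF assms(1,2), of k "inv\<^bsub>free_group n\<^esub> g"] walk_inv(1)[OF assms] assms(3)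
        m_closed[of k "inv\<^bsub>free_group n\<^esub> g"]
      by (simp add: stabilizer_def del: mult_free_group)
    moreover have "k = (k \<otimes>\<^bsub>free_group n\<^esub> inv\<^bsub>free_group n\<^esub> g) \<otimes>\<^bsub>free_group n\<^esub> g"
      using k assms(3) by (simp add: m_assoc del: mult_free_group one_free_group)
    ultimately show "k \<in> ?L"
      unfolding r_coset_def by blast
  qed
qed

text \<open>Sending a vertex to the set of elements that lead to it from the root identifies the graph with
  the coset graph of the stabilizer of the root.\<close>

lemma coset_graph_stabilizer:
  assumes G: "schreier_graph n G" and x: "x \<in> verts G"
  shows "lgraph_iso (\<lambda>v. {g \<in> carrier (free_group n). walk G x g = v}) G
    (coset_graph n (stabilizer n G x))" (is "lgraph_iso ?f G ?C")
    and "{g \<in> carrier (free_group n). walk G x g = x} = stabilizer n G x"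
proof -
  interpret group "free_group n" by (rule group_free_group)
  have coset: "stabilizer n G x #>\<^bsub>free_group n\<^esub> g = ?f (walk G x g)" if "g \<in> carrier (free_group n)" for g
    using stabilizer_coset[OF G x that] .
  have inj: "u = v" if uv: "?f u = ?f v" "u \<in> verts G" for u v
  proof -
    obtain g where "g \<in> carrier (free_group n)" "walk G x g = u"
      using schreier_connected[OF G x uv(2)] .
    then show "u = v"
      using uv(1) by blast
  qed
  have verts: "verts ?C = ?f ` verts G"
  proof -
    have "verts ?C = (\<lambda>g. ?f (walk G x g)) ` carrier (free_group n)"
      by (auto simp: coset_graph_def RCOSETS_def coset)
    also have "\<dots> = ?f ` walk G x ` carrier (free_group n)"
      by (simp only: image_image)
    also have "walk G x ` carrier (free_group n) = verts G"
      using walk_carrier_verts[OF G x] by (auto elim: schreier_connected[OF G x])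
    finally show ?thesis .
  qed
  have edges: "(u, i, v) \<in> edges G \<longleftrightarrow> (?f u, i, ?f v) \<in> edges ?C"
    if u: "u \<in> verts G" and v: "v \<in> verts G" for u v i
  proof -
    have gen: "walk G x (g \<otimes>\<^bsub>free_group n\<^esub> generator i) = walk_step G (walk G x g) (i, True)"
      "g \<otimes>\<^bsub>free_group n\<^esub> generator i \<in> carrier (free_group n)" "walk G x g \<in> verts G"
      if "i \<in> {1..n}" "g \<in> carrier (free_group n)" for g i
    proof -
      have *: "generator i \<in> carrier (free_group n)"
        using that singleton_carrier[of "(i, True)" n] by (simp add: letters_def generator_def)
      show "walk G x (g \<otimes>\<^bsub>free_group n\<^esub> generator i) = walk_step G (walk G x g) (i, True)"
        using walk_mult[OF G x that(2) *] by (simp add: generator_def)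
      show "g \<otimes>\<^bsub>free_group n\<^esub> generator i \<in> carrier (free_group n)"
        using m_closed[OF that(2) *] .
      show "walk G x g \<in> verts G"
        using walk_carrier_verts[OF G x that(2)] .
    qed
    have step: "walk_step G u (i, True) = v \<longleftrightarrow> (u, i, v) \<in> edges G" if "i \<in> {1..n}" for i
      using walk_step_iff[OF G u, of "(i, True)" v] that by (simp add: letters_def letter_edge_def)
    show ?thesis
    proof
      assume e: "(u, i, v) \<in> edges G"
      then have i: "i \<in> {1..n}"
        using G by (auto simp: schreier_graph_def)
      obtain g where g: "g \<in> carrier (free_group n)" "walk G x g = u"
        using schreier_connected[OF G x u] .
      have "?f u = stabilizer n G x #>\<^bsub>free_group n\<^esub> g"
        "?f v = stabilizer n G x #>\<^bsub>free_group n\<^esub> (g \<otimes>\<^bsub>free_group n\<^esub> generator i)"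
        using coset[OF g(1)] coset[OF gen(2)[OF i g(1)]] gen(1)[OF i g(1)] step[OF i] e g(2)
        by simp_all
      moreover have "(stabilizer n G x #>\<^bsub>free_group n\<^esub> g, i,
          stabilizer n G x #>\<^bsub>free_group n\<^esub> (g \<otimes>\<^bsub>free_group n\<^esub> generator i)) \<in> edges ?C"
        unfolding coset_graph_def using g(1) i by (simp del: mult_free_group) blast
      ultimately show "(?f u, i, ?f v) \<in> edges ?C"
        by (simp only:)
    next
      assume "(?f u, i, ?f v) \<in> edges ?C"
      then obtain g where g: "g \<in> carrier (free_group n)" and i: "i \<in> {1..n}"
        and *: "?f u = stabilizer n G x #>\<^bsub>free_group n\<^esub> g"
        "?f v = stabilizer n G x #>\<^bsub>free_group n\<^esub> (g \<otimes>\<^bsub>free_group n\<^esub> generator i)"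
        unfolding coset_graph_def lgraph.simps by blast
      have "u = walk G x g"
        by (rule inj) (use * coset[OF g] u in simp_all)
      moreover have "v = walk G x (g \<otimes>\<^bsub>free_group n\<^esub> generator i)"
        by (rule inj) (use * coset[OF gen(2)[OF i g]] v in simp_all)
      ultimately show "(u, i, v) \<in> edges G"
        using gen(1)[OF i g] step[OF i] by simp
    qed
  qed
  have "bij_betw ?f (verts G) (verts ?C)"
    unfolding verts by (intro inj_on_imp_bij_betw inj_onI inj)
  then show "lgraph_iso ?f G ?C"
    unfolding lgraph_iso_def using edges by blast
  show "?f x = stabilizer n G x"
    by (simp add: stabilizer_def)
qed

text \<open>A subgroup can be read off from its coset graph: an isomorphism transports the path labelled
  \<open>g\<close> from \<open>H\<close> to \<open>H g\<close>, and that path is closed iff \<open>g \<in> H\<close>.\<close>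

lemma stabilizer_eq_if_coset_graph_iso:
  assumes H: "subgroup H (free_group n)" and G: "schreier_graph n G"
    and f: "lgraph_iso f (coset_graph n H) G" "f H = x"
  shows "stabilizer n G x = H"
proof -
  interpret group "free_group n" by (rule group_free_group)
  have sub: "H \<subseteq> carrier (free_group n)"
    using H by (rule subgroup.subset)
  have root: "H #>\<^bsub>free_group n\<^esub> [] = H"
    using coset_mult_one[OF sub] by simp
  have verts: "H #>\<^bsub>free_group n\<^esub> g \<in> verts (coset_graph n H)" if "g \<in> carrier (free_group n)" for g
    using that by (auto simp: coset_graph_def RCOSETS_def)
  have x: "x \<in> verts G"
    using lgraph_iso_verts[OF f(1) verts[OF Nil_carrier]] root f(2) by simp
  have walk: "f (H #>\<^bsub>free_group n\<^esub> g) = walk G x g" if "g \<in> carrier (free_group n)" for g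
    using that
  proof (induction g rule: rev_induct)
    case Nil
    then show ?case using root f(2) by simp
  next
    case (snoc l g)
    have l: "l \<in> letters n" and g: "g \<in> carrier (free_group n)"
      using snoc.prems by (auto simp: carrier_free_group reduced_word_def nth_append split: if_splits)
    have gl: "g \<otimes>\<^bsub>free_group n\<^esub> [l] = g @ [l]" "(g @ [l]) \<otimes>\<^bsub>free_group n\<^esub> [letter_inv l] = g"
    proof -
      show *: "g \<otimes>\<^bsub>free_group n\<^esub> [l] = g @ [l]"
        using foldr_push_reduced[of g "[l]"] snoc.prems by (simp add: carrier_free_group)
      show "(g @ [l]) \<otimes>\<^bsub>free_group n\<^esub> [letter_inv l] = g"
        using foldr_push_reduced[of g "[]"] g by (simp add: carrier_free_group)
    qed
    have "letter_edge (coset_graph n H) (H #>\<^bsub>free_group n\<^esub> g) l (H #>\<^bsub>free_group n\<^esub> (g @ [l]))"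
    proof (cases "snd l")
      case True
      then have "generator (fst l) = [l]"
        by (simp add: generator_def prod_eq_iff)
      then show ?thesis
        using True g l gl(1) by (force simp: letter_edge_def coset_graph_def letters_def)
    next
      case False
      then have "generator (fst l) = [letter_inv l]"
        by (simp add: generator_def letter_inv_def)
      then show ?thesis
        using False snoc.prems l gl(2) by (force simp: letter_edge_def coset_graph_def letters_def)
    qed
    then have "letter_edge G (walk G x g) l (f (H #>\<^bsub>free_group n\<^esub> (g @ [l])))"
      using lgraph_iso_letter_edge[OF f(1) verts[OF g] verts[OF snoc.prems]] snoc.IH[OF g] by simp
    then show ?case
      using walk_step_iff[OF G walk_carrier_verts[OF G x g] l, THEN iffD2] by simp
  qed
  have "walk G x g = x \<longleftrightarrow> g \<in> H" if g: "g \<in> carrier (free_group n)" for g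
  proof -
    have "walk G x g = x \<longleftrightarrow> H #>\<^bsub>free_group n\<^esub> g = H #>\<^bsub>free_group n\<^esub> []"
      using lgraph_iso_inj[OF f(1) verts[OF g] verts[OF Nil_carrier]] walk[OF g] root f(2) by simp
    also have "\<dots> \<longleftrightarrow> g \<in> H"
      using root coset_join1[OF _ g H] coset_join2[OF g H] by auto
    finally show ?thesis .
  qed
  then show ?thesis
    using sub by (auto simp: stabilizer_def)
qed

lemma schreier_class_stabilizer:
  assumes "schreier_graph n G" "x \<in> verts G"
  shows "schreier_class n (stabilizer n G x) = rclass n (G, x)"
proof -
  have *: "rooted_isomorphic (G, x) (coset_graph n (stabilizer n G x), stabilizer n G x)"
    using coset_graph_stabilizer[OF assms] by (auto simp: rooted_isomorphic_def)
  show ?thesis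
    using rooted_isomorphic_trans[OF *] rooted_isomorphic_trans[OF rooted_isomorphic_sym[OF * assms(2)]]
    by (auto simp: schreier_class_def rclass_def)
qed

lemma rclass_eq_if_stabilizer_eq:
  assumes "schreier_graph n G" "x \<in> verts G" "schreier_graph n G'" "x' \<in> verts G'"
    and "stabilizer n G x = stabilizer n G' x'"
  shows "rclass n (G, x) = rclass n (G', x')"
  using schreier_class_stabilizer[OF assms(1,2)] schreier_class_stabilizer[OF assms(3,4)] assms(5) by simp

lemma conj_subgroup_stabilizer:
  assumes G: "schreier_graph n G" "x \<in> verts G" and g: "g \<in> carrier (free_group n)"
  shows "conj_subgroup n g (stabilizer n G x) = stabilizer n G (walk G x (inv\<^bsub>free_group n\<^esub> g))"
    (is "?L = ?R")
proof -
  interpret group "free_group n" by (rule group_free_group)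
  let ?F = "free_group n"
  have ig: "inv\<^bsub>?F\<^esub> g \<in> carrier ?F" using g by simp
  have x': "walk G x (inv\<^bsub>?F\<^esub> g) \<in> verts G" by (rule walk_carrier_verts[OF G ig])
  show ?thesis
  proof (intro equalityI subsetI)
    fix k assume "k \<in> ?L"
    then obtain h where h: "h \<in> carrier ?F" "walk G x h = x" "k = g \<otimes>\<^bsub>?F\<^esub> h \<otimes>\<^bsub>?F\<^esub> inv\<^bsub>?F\<^esub> g"
      by (auto simp: conj_subgroup_def stabilizer_def)
    then show "k \<in> ?R"
      using g ig m_closed[OF g h(1)] m_closed[OF m_closed[OF g h(1)] ig]
        walk_mult[OF G(1) x' m_closed[OF g h(1)] ig] walk_mult[OF G(1) x' g h(1)] walk_inv(2)[OF G g]
      by (simp add: stabilizer_def del: mult_free_group)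
  next
    fix k assume "k \<in> ?R"
    then have k: "k \<in> carrier ?F" "walk G (walk G x (inv\<^bsub>?F\<^esub> g)) k = walk G x (inv\<^bsub>?F\<^esub> g)"
      by (auto simp: stabilizer_def)
    have kg: "inv\<^bsub>?F\<^esub> g \<otimes>\<^bsub>?F\<^esub> k \<in> carrier ?F" "inv\<^bsub>?F\<^esub> g \<otimes>\<^bsub>?F\<^esub> k \<otimes>\<^bsub>?F\<^esub> g \<in> carrier ?F"
      using m_closed ig k(1) g by blast+
    have "walk G x (inv\<^bsub>?F\<^esub> g \<otimes>\<^bsub>?F\<^esub> k \<otimes>\<^bsub>?F\<^esub> g) = x"
      using walk_mult[OF G kg(1) g] walk_mult[OF G ig k(1)] k(2) walk_inv(2)[OF G g]
      by (simp del: mult_free_group)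
    then have "inv\<^bsub>?F\<^esub> g \<otimes>\<^bsub>?F\<^esub> k \<otimes>\<^bsub>?F\<^esub> g \<in> stabilizer n G x"
      using kg by (simp add: stabilizer_def)
    moreover have "k = g \<otimes>\<^bsub>?F\<^esub> (inv\<^bsub>?F\<^esub> g \<otimes>\<^bsub>?F\<^esub> k \<otimes>\<^bsub>?F\<^esub> g) \<otimes>\<^bsub>?F\<^esub> inv\<^bsub>?F\<^esub> g"
    proof -
      have "g \<otimes>\<^bsub>?F\<^esub> (inv\<^bsub>?F\<^esub> g \<otimes>\<^bsub>?F\<^esub> k \<otimes>\<^bsub>?F\<^esub> g) \<otimes>\<^bsub>?F\<^esub> inv\<^bsub>?F\<^esub> g =
          (g \<otimes>\<^bsub>?F\<^esub> inv\<^bsub>?F\<^esub> g) \<otimes>\<^bsub>?F\<^esub> k \<otimes>\<^bsub>?F\<^esub> (g \<otimes>\<^bsub>?F\<^esub> inv\<^bsub>?F\<^esub> g)"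
        by (simp only: m_assoc k(1) g ig m_closed)
      then show ?thesis
        using k(1) g by (simp del: mult_free_group one_free_group)
    qed
    ultimately show "k \<in> ?L"
      unfolding conj_subgroup_def by blast
  qed
qed

text \<open>The action is defined through a preimage of the class under \<open>schreier_class\<close>. The preimage can
  only be the stabilizer of the root, and conjugating the stabilizer by \<open>g\<close> moves the root by
  \<open>g\<inverse>\<close>.\<close>

lemma conj_act_eq_move_root:
  assumes c: "c \<in> Lambda n" and g: "g \<in> carrier (free_group n)"
  shows "conj_act n g c = move_root (inv\<^bsub>free_group n\<^esub> g) c"
proof -
  obtain G x where G: "schreier_graph n G" "x \<in> verts G" and c_eq: "c = rclass n (G, x)"
    using c by (rule LambdaE)
  define H where "H = inv_into (subgroups n) (schreier_class n) c"
  have "c \<in> schreier_class n ` subgroups n"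
    using schreier_class_stabilizer[OF G] subgroup_stabilizer[OF G] by (force simp: c_eq subgroups_def)
  then have H: "H \<in> subgroups n" "schreier_class n H = c"
    unfolding H_def by (rule inv_into_into, rule f_inv_into_f)
  then have "(G, x) \<in> schreier_class n H"
    using G by (simp add: c_eq mem_rclass rooted_isomorphic_refl)
  then obtain f where "lgraph_iso f (coset_graph n H) G" "f H = x"
    by (auto simp: schreier_class_def rooted_isomorphic_def)
  then have "H = stabilizer n G x"
    using stabilizer_eq_if_coset_graph_iso[of H n G] H(1) G by (simp add: subgroups_def)
  moreover have ig: "inv\<^bsub>free_group n\<^esub> g \<in> carrier (free_group n)"
    using g by (simp add: group.inv_closed group_free_group)
  ultimately have "conj_act n g c = rclass n (G, walk G x (inv\<^bsub>free_group n\<^esub> g))"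
    using schreier_class_stabilizer[OF G(1) walk_carrier_verts[OF G ig]] 
    by (simp add: conj_act_def conj_subgroup_stabilizer[OF G g] flip: H_def)
  then show ?thesis
    using move_root_rclass[OF G, of "inv\<^bsub>free_group n\<^esub> g"] ig by (simp add: c_eq carrier_free_group)
qed

section \<open>Neighbourhoods and closed words\<close>

text \<open>Equality of the stabilizers of the two roots up to length \<open>r\<close>, formulated with arbitrary words
  so that words can be concatenated without reduction.\<close>

definition same_loops :: "nat \<Rightarrow> nat \<Rightarrow> 'v lgraph \<Rightarrow> 'v \<Rightarrow> 'w lgraph \<Rightarrow> 'w \<Rightarrow> bool" where
  "same_loops n r G x G' x' \<longleftrightarrow>
     (\<forall>w. set w \<subseteq> letters n \<and> length w \<le> r \<longrightarrow> (walk G x w = x \<longleftrightarrow> walk G' x' w = x'))"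

lemma same_loops_refl: "same_loops n r G x G x"
  by (simp add: same_loops_def)

lemma same_loops_sym: "same_loops n r G x G' x' \<Longrightarrow> same_loops n r G' x' G x"
  by (simp add: same_loops_def)

lemma same_loops_trans:
  "same_loops n r G x G' x' \<Longrightarrow> same_loops n r G' x' G'' x'' \<Longrightarrow> same_loops n r G x G'' x''"
  by (simp add: same_loops_def)

lemma same_loops_mono: "same_loops n r G x G' x' \<Longrightarrow> s \<le> r \<Longrightarrow> same_loops n s G x G' x'"
  by (auto simp: same_loops_def)

text \<open>Two words lead to the same vertex iff the first followed by the inverse of the second is
  closed.\<close>

lemma same_loops_walk_eq:
  assumes "schreier_graph n G" "x \<in> verts G" "schreier_graph n G'" "x' \<in> verts G'"
    and "same_loops n r G x G' x'" "set u \<subseteq> letters n" "set v \<subseteq> letters n" "length u + length v \<le> r"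
  shows "walk G x u = walk G x v \<longleftrightarrow> walk G' x' u = walk G' x' v"
proof -
  have "set (u @ inv_word v) \<subseteq> letters n" "length (u @ inv_word v) \<le> r"
    using assms(6-8) by auto
  then show ?thesis
    using assms(5) walk_eq_iff[OF assms(1,2,6,7)] walk_eq_iff[OF assms(3,4,6,7)]
    unfolding same_loops_def by blast
qed

lemma same_loops_if_rooted_isomorphic:
  assumes "schreier_graph n G" "x \<in> verts G" "schreier_graph n G'"
    and "rooted_isomorphic (G, x) (G', x')"
  shows "same_loops n r G x G' x'"
proof -
  obtain f where f: "lgraph_iso f G G'" "f x = x'"
    using assms by (auto simp: rooted_isomorphic_def)
  show ?thesis
    unfolding same_loops_def
  proof (intro allI impI)
    fix w assume "set w \<subseteq> letters n \<and> length w \<le> r"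
    then show "walk G x w = x \<longleftrightarrow> walk G' x' w = x'"
      using lgraph_iso_walk[OF assms(1,3) f(1) assms(2), of w] f(2)
        lgraph_iso_inj[OF f(1) walk_verts[OF assms(1,2)] assms(2), of w] by simp
  qed
qed

text \<open>A word \<open>v\<close> is closed at the endpoint of \<open>w\<close> iff \<open>w v w\<inverse>\<close> is closed at the root; hence the
  loss of twice the length of \<open>w\<close>.\<close>

lemma same_loops_walk:
  assumes "schreier_graph n G" "x \<in> verts G" "schreier_graph n G'" "x' \<in> verts G'"
    and "same_loops n (r + 2 * length w) G x G' x'" "set w \<subseteq> letters n"
  shows "same_loops n r G (walk G x w) G' (walk G' x' w)"
  unfolding same_loops_def
proof (intro allI impI)
  fix v assume v: "set v \<subseteq> letters n \<and> length v \<le> r"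
  have "walk G x (w @ v) = walk G x w \<longleftrightarrow> walk G' x' (w @ v) = walk G' x' w"
    using assms(6) v by (intro same_loops_walk_eq[OF assms(1-5)]) auto
  then show "walk G (walk G x w) v = walk G x w \<longleftrightarrow> walk G' (walk G' x' w) v = walk G' x' w"
    by simp
qed

lemma relpow_adjacency_iff_walk:
  assumes "schreier_graph n G" "x \<in> verts G"
  shows "(x, v) \<in> adjacency G ^^ k \<longleftrightarrow> (\<exists>u. set u \<subseteq> letters n \<and> length u = k \<and> walk G x u = v)"
proof (induction k arbitrary: v)
  case 0
  then show ?case by auto
next
  case (Suc k)
  have step: "(y, z) \<in> adjacency G \<longleftrightarrow> (\<exists>l\<in>letters n. walk_step G y l = z)" if "y \<in> verts G" for y z
    using adjacency_iff_letter_edge[OF assms(1)] walk_step_iff[OF assms(1) that] by blast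
  have "(x, v) \<in> adjacency G ^^ Suc k \<longleftrightarrow>
      (\<exists>u. set u \<subseteq> letters n \<and> length u = k \<and> (walk G x u, v) \<in> adjacency G)"
    using Suc.IH by (auto simp: relcomp_unfold)
  also have "\<dots> \<longleftrightarrow> (\<exists>u l. set u \<subseteq> letters n \<and> length u = k \<and> l \<in> letters n \<and> walk G x (u @ [l]) = v)"
    using step[OF walk_verts[OF assms]] by (simp add: Bex_def) blast
  also have "\<dots> \<longleftrightarrow> (\<exists>u. set u \<subseteq> letters n \<and> length u = Suc k \<and> walk G x u = v)"
  proof (intro iffI; elim exE)
    fix u l
    assume "set u \<subseteq> letters n \<and> length u = k \<and> l \<in> letters n \<and> walk G x (u @ [l]) = v"
    then show "\<exists>u. set u \<subseteq> letters n \<and> length u = Suc k \<and> walk G x u = v"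
      by (intro exI[of _ "u @ [l]"]) auto
  next
    fix u
    assume *: "set u \<subseteq> letters n \<and> length u = Suc k \<and> walk G x u = v"
    then obtain u' l where "u = u' @ [l]"
      by (cases u rule: rev_cases) auto
    with * show "\<exists>u l. set u \<subseteq> letters n \<and> length u = k \<and> l \<in> letters n \<and> walk G x (u @ [l]) = v"
      by (intro exI[of _ u'] exI[of _ l]) auto
  qed
  finally show ?case .
qed

lemma ball_verts_iff_walk:
  assumes "schreier_graph n G" "x \<in> verts G"
  shows "v \<in> ball_verts G x r \<longleftrightarrow> (\<exists>u. set u \<subseteq> letters n \<and> length u \<le> r \<and> walk G x u = v)"
  using walk_verts[OF assms] by (auto simp: ball_verts_def relpow_adjacency_iff_walk[OF assms])

lemma walk_in_ball:
  assumes "schreier_graph n G" "x \<in> verts G" "set u \<subseteq> letters n" "length u \<le> r"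
  shows "walk G x u \<in> ball_verts G x r"
  using assms(3,4) unfolding ball_verts_iff_walk[OF assms(1,2)] by blast

lemma letter_edge_nbhd:
  "letter_edge (nbhd r G x) u l v \<longleftrightarrow>
    letter_edge G u l v \<and> u \<in> ball_verts G x r \<and> v \<in> ball_verts G x r"
  by (auto simp: letter_edge_def nbhd_def)

lemma verts_nbhd [simp]: "verts (nbhd r G x) = ball_verts G x r"
  by (simp add: nbhd_def)

text \<open>A walk of length at most \<open>r\<close> stays in the \<open>r\<close>-neighbourhood, which contains all edges between
  its vertices.\<close>

lemma lgraph_iso_nbhd_walk:
  assumes G: "schreier_graph n G" "x \<in> verts G" and G': "schreier_graph n G'" "x' \<in> verts G'"
    and f: "lgraph_iso f (nbhd r G x) (nbhd r G' x')" "f x = x'"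
    and u: "set u \<subseteq> letters n" "length u \<le> r"
  shows "f (walk G x u) = walk G' x' u"
  using u
proof (induction u rule: rev_induct)
  case (snoc l u)
  have l: "l \<in> letters n" and u: "set u \<subseteq> letters n" "length u \<le> r"
    using snoc.prems by auto
  let ?a = "walk G x u" and ?b = "walk_step G (walk G x u) l"
  have "walk G x (u @ [l]) \<in> verts (nbhd r G x)" and a: "?a \<in> verts (nbhd r G x)"
    using snoc.prems u unfolding verts_nbhd ball_verts_iff_walk[OF G] by blast+
  then have ab: "?a \<in> verts (nbhd r G x)" "?b \<in> verts (nbhd r G x)"
    by simp_all
  have "letter_edge G ?a l ?b"
    using walk_step_iff[OF G(1) walk_verts[OF G u(1)] l] by blast
  then have "letter_edge (nbhd r G x) ?a l ?b"
    using ab by (simp add: letter_edge_nbhd)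
  then have "letter_edge G' (f ?a) l (f ?b)"
    using lgraph_iso_letter_edge[OF f(1) ab, of l] unfolding letter_edge_nbhd by blast
  then show ?case
    using walk_step_iff[OF G'(1) walk_verts[OF G' u(1)] l, THEN iffD2] snoc.IH[OF u] by simp
qed (use f in simp)

text \<open>The isomorphism sends the endpoint of a word of length at most \<open>r\<close> to the endpoint of the same
  word in the other graph. That this is well defined and injective concerns closed words of length
  at most \<open>2 r\<close>; an edge between two vertices of the neighbourhood contributes one more letter.\<close>

lemma lgraph_iso_nbhd_if_same_loops:
  assumes G: "schreier_graph n G" "x \<in> verts G" and G': "schreier_graph n G'" "x' \<in> verts G'"
    and loops: "same_loops n (2 * r + 1) G x G' x'"
  shows "\<exists>f. lgraph_iso f (nbhd r G x) (nbhd r G' x') \<and>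
    (\<forall>u. set u \<subseteq> letters n \<and> length u \<le> r \<longrightarrow> f (walk G x u) = walk G' x' u)"
proof -
  define f where "f v = walk G' x' (SOME u. set u \<subseteq> letters n \<and> length u \<le> r \<and> walk G x u = v)" for v
  have f: "f (walk G x u) = walk G' x' u" if u: "set u \<subseteq> letters n" "length u \<le> r" for u
  proof -
    define v where "v = (SOME v. set v \<subseteq> letters n \<and> length v \<le> r \<and> walk G x v = walk G x u)"
    have v: "set v \<subseteq> letters n \<and> length v \<le> r \<and> walk G x v = walk G x u"
      unfolding v_def by (rule someI[of _ u]) (use u in simp)
    then have "length v + length u \<le> 2 * r + 1"
      using u by simp
    then have "walk G' x' v = walk G' x' u"
      using same_loops_walk_eq[OF G G' loops, of v u] u(1) v by blast
    then show ?thesis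
      by (simp add: f_def v_def)
  qed
  have ballE: thesis if "a \<in> ball_verts G x r"
    "\<And>u. set u \<subseteq> letters n \<Longrightarrow> length u \<le> r \<Longrightarrow> a = walk G x u \<Longrightarrow> thesis" for a thesis
    using that unfolding ball_verts_iff_walk[OF G] by blast
  have "lgraph_iso f (nbhd r G x) (nbhd r G' x')"
    unfolding lgraph_iso_def verts_nbhd
  proof (intro conjI ballI allI)
    have "inj_on f (ball_verts G x r)"
    proof (rule inj_onI)
      fix a b assume a: "a \<in> ball_verts G x r" and b: "b \<in> ball_verts G x r" and eq: "f a = f b"
      obtain u where u: "set u \<subseteq> letters n" "length u \<le> r" "a = walk G x u"
        by (rule ballE[OF a])
      obtain v where v: "set v \<subseteq> letters n" "length v \<le> r" "b = walk G x v"
        by (rule ballE[OF b])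
      have "walk G' x' u = walk G' x' v"
        using eq f[OF u(1,2)] f[OF v(1,2)] u(3) v(3) by metis
      then show "a = b"
        using same_loops_walk_eq[OF G G' loops u(1) v(1)] u v by simp
    qed
    moreover have "f ` ball_verts G x r = ball_verts G' x' r"
    proof (intro equalityI subsetI)
      fix b assume "b \<in> f ` ball_verts G x r"
      then obtain a where a: "a \<in> ball_verts G x r" "b = f a" by blast
      obtain u where u: "set u \<subseteq> letters n" "length u \<le> r" "a = walk G x u"
        by (rule ballE[OF a(1)])
      have "walk G' x' u = b"
        using a(2) f[OF u(1,2)] u(3) by simp
      then show "b \<in> ball_verts G' x' r"
        using walk_in_ball[OF G' u(1,2)] by simp
    next
      fix b assume "b \<in> ball_verts G' x' r"
      then obtain u where u: "set u \<subseteq> letters n" "length u \<le> r" "b = walk G' x' u"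
        unfolding ball_verts_iff_walk[OF G'] by blast
      then have "walk G x u \<in> ball_verts G x r"
        unfolding ball_verts_iff_walk[OF G] by blast
      then show "b \<in> f ` ball_verts G x r"
        using f[OF u(1,2)] u(3) by (metis image_eqI)
    qed
    ultimately show "bij_betw f (ball_verts G x r) (ball_verts G' x' r)"
      by (simp add: bij_betw_def)
  next
    fix a b i assume a: "a \<in> ball_verts G x r" and b: "b \<in> ball_verts G x r"
    obtain u where u: "set u \<subseteq> letters n" "length u \<le> r" "a = walk G x u"
      by (rule ballE[OF a])
    obtain v where v: "set v \<subseteq> letters n" "length v \<le> r" "b = walk G x v"
      by (rule ballE[OF b])
    have fab: "f a = walk G' x' u" "f b = walk G' x' v"
      using f[OF u(1,2)] f[OF v(1,2)] u(3) v(3) by simp_all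
    then have ball: "f a \<in> ball_verts G' x' r" "f b \<in> ball_verts G' x' r"
      using walk_in_ball[OF G' u(1,2)] walk_in_ball[OF G' v(1,2)] by simp_all
    have "(a, i, b) \<in> edges G \<longleftrightarrow> (f a, i, f b) \<in> edges G'"
    proof (cases "i \<in> {1..n}")
      case True
      have "letter_edge G a (i, True) b \<longleftrightarrow> walk G x (u @ [(i, True)]) = walk G x v"
        using walk_step_iff[OF G(1) walk_verts[OF G u(1)], of "(i, True)"] True u(3) v(3)
        by (simp add: letters_def)
      also have "\<dots> \<longleftrightarrow> walk G' x' (u @ [(i, True)]) = walk G' x' v"
        using u v True by (intro same_loops_walk_eq[OF G G' loops]) (auto simp: letters_def)
      also have "\<dots> \<longleftrightarrow> letter_edge G' (f a) (i, True) (f b)"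
        using walk_step_iff[OF G'(1) walk_verts[OF G' u(1)], of "(i, True)"] True fab
        by (simp add: letters_def)
      finally show ?thesis
        by (simp add: letter_edge_def)
    next
      case False
      then show ?thesis
        using G(1) G'(1) by (auto simp: schreier_graph_def)
    qed
    then show "(a, i, b) \<in> edges (nbhd r G x) \<longleftrightarrow> (f a, i, f b) \<in> edges (nbhd r G' x')"
      using a b ball by (simp add: nbhd_def)
  qed
  with f show ?thesis by blast
qed

lemma birooted_isomorphic_nbhd_if_same_loops:
  assumes "schreier_graph n G" "x \<in> verts G" "schreier_graph n G'" "x' \<in> verts G'"
    and "same_loops n (2 * r + 1) G x G' x'" "set u \<subseteq> letters n" "length u \<le> r"
  shows "birooted_isomorphic (nbhd r G x, x, walk G x u) (nbhd r G' x', x', walk G' x' u)"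
proof -
  obtain f where f: "lgraph_iso f (nbhd r G x) (nbhd r G' x')"
    "\<forall>u. set u \<subseteq> letters n \<and> length u \<le> r \<longrightarrow> f (walk G x u) = walk G' x' u"
    using lgraph_iso_nbhd_if_same_loops[OF assms(1-5)] by blast
  have "f x = x'" "f (walk G x u) = walk G' x' u"
    using f(2)[THEN spec, of "[]"] f(2) assms(6,7) by simp_all
  then show ?thesis
    using f(1) by (auto simp: birooted_isomorphic_def)
qed

lemma rooted_isomorphic_nbhd_if_same_loops:
  assumes "schreier_graph n G" "x \<in> verts G" "schreier_graph n G'" "x' \<in> verts G'"
    and "same_loops n (2 * r + 1) G x G' x'"
  shows "rooted_isomorphic (nbhd r G x, x) (nbhd r G' x', x')"
  using birooted_isomorphic_nbhd_if_same_loops[OF assms, of "[]"] by (simp add: rooted_iff_birooted)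

lemma root_in_ball: "x \<in> verts G \<Longrightarrow> x \<in> ball_verts G x r"
  by (auto simp: ball_verts_def intro: exI[of _ 0])

lemma same_loops_if_rooted_isomorphic_nbhd:
  assumes G: "schreier_graph n G" "x \<in> verts G" and G': "schreier_graph n G'" "x' \<in> verts G'"
    and "rooted_isomorphic (nbhd r G x, x) (nbhd r G' x', x')"
  shows "same_loops n r G x G' x'"
proof -
  obtain f where f: "lgraph_iso f (nbhd r G x) (nbhd r G' x')" "f x = x'"
    using assms by (auto simp: rooted_isomorphic_def)
  show ?thesis
    unfolding same_loops_def
  proof (intro allI impI)
    fix w assume w: "set w \<subseteq> letters n \<and> length w \<le> r"
    then have "walk G x w \<in> verts (nbhd r G x)"
      unfolding verts_nbhd ball_verts_iff_walk[OF G] by blast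
    then show "walk G x w = x \<longleftrightarrow> walk G' x' w = x'"
      using lgraph_iso_inj[OF f(1), of "walk G x w" x] lgraph_iso_nbhd_walk[OF G G' f, of w] w f(2)
        root_in_ball[OF G(2)] by simp
  qed
qed

section \<open>The topology of the space of Schreier graphs\<close>

text \<open>Membership in a cylinder can be tested on any representative of the class.\<close>

lemma rclass_mem_cylinder_iff:
  assumes G: "schreier_graph n G" "x \<in> verts G"
  shows "rclass n (G, x) \<in> cylinder n r (G0, x0) \<longleftrightarrow>
    rooted_isomorphic (nbhd r G x, x) (nbhd r G0 x0, x0)" (is "_ \<longleftrightarrow> ?R")
proof
  assume "rclass n (G, x) \<in> cylinder n r (G0, x0)"
  then obtain G' :: "nat lgraph" and x'
    where G': "schreier_graph n G'" "x' \<in> verts G'" "rooted_isomorphic (G, x) (G', x')"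
    and iso: "rooted_isomorphic (nbhd r G' x', x') (nbhd r G0 x0, x0)"
    by (auto simp: cylinder_def mem_rclass)
  have "rooted_isomorphic (nbhd r G x, x) (nbhd r G' x', x')"
    using rooted_isomorphic_nbhd_if_same_loops[OF G G'(1,2)]
      same_loops_if_rooted_isomorphic[OF G G'(1,3)] by blast
  then show ?R
    using iso by (rule rooted_isomorphic_trans)
next
  assume ?R
  then show "rclass n (G, x) \<in> cylinder n r (G0, x0)"
    using G by (auto simp: cylinder_def mem_rclass intro!: bexI[of _ "(G, x)"] rooted_isomorphic_refl)
qed

lemma bclass_mem_cylinder2_iff:
  assumes G: "schreier_graph n G" "x \<in> verts G" "y \<in> verts G"
  shows "bclass n (G, x, y) \<in> cylinder2 n r (G0, x0, y0) \<longleftrightarrow>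
    y \<in> ball_verts G x r \<and> birooted_isomorphic (nbhd r G x, x, y) (nbhd r G0 x0, x0, y0)" (is "_ \<longleftrightarrow> ?R")
proof
  assume "bclass n (G, x, y) \<in> cylinder2 n r (G0, x0, y0)"
  then obtain G' :: "nat lgraph" and x' y' where G': "schreier_graph n G'" "x' \<in> verts G'"
      "birooted_isomorphic (G, x, y) (G', x', y')"
    and y': "y' \<in> ball_verts G' x' r"
    and iso: "birooted_isomorphic (nbhd r G' x', x', y') (nbhd r G0 x0, x0, y0)"
    by (auto simp: cylinder2_def mem_bclass)
  obtain f where f: "lgraph_iso f G G'" "f x = x'" "f y = y'"
    using G'(3) by (auto simp: birooted_isomorphic_def)
  obtain u where u: "set u \<subseteq> letters n" "length u \<le> r" "walk G' x' u = y'"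
    using y' unfolding ball_verts_iff_walk[OF G'(1,2)] by blast
  have "f (walk G x u) = f y"
    using lgraph_iso_walk[OF G(1) G'(1) f(1) G(2) u(1)] f u by simp
  then have y: "walk G x u = y"
    using lgraph_iso_inj[OF f(1) walk_verts[OF G(1,2) u(1)] G(3)] by simp
  have "rooted_isomorphic (G, x) (G', x')"
    using f by (auto simp: rooted_isomorphic_def)
  then have "birooted_isomorphic (nbhd r G x, x, y) (nbhd r G' x', x', y')"
    using birooted_isomorphic_nbhd_if_same_loops[OF G(1,2) G'(1,2) _ u(1,2)]
      same_loops_if_rooted_isomorphic[OF G(1,2) G'(1)] u(3) y by blast
  then show ?R
    using birooted_isomorphic_trans[OF _ iso] walk_in_ball[OF G(1,2) u(1,2)] y by simp
next
  assume ?R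
  then show "bclass n (G, x, y) \<in> cylinder2 n r (G0, x0, y0)"
    using G by (auto simp: cylinder2_def mem_bclass intro!: bexI[of _ "(G, x, y)"] birooted_isomorphic_refl)
qed

lemma topspace_Lambda_top [simp]: "topspace (Lambda_top n) = Lambda n"
proof -
  have "c \<in> \<Union>{cylinder n r p | r p. p \<in> rooted_schreier n}" if c: "c \<in> Lambda n" for c
  proof -
    obtain G x where G: "schreier_graph n G" "x \<in> verts G" "c = rclass n (G, x)"
      using c by (rule LambdaE)
    then have "c \<in> cylinder n 0 (G, x)"
      by (simp add: rclass_mem_cylinder_iff rooted_isomorphic_refl)
    then show ?thesis
      using G by auto
  qed
  moreover have "cylinder n r p \<subseteq> Lambda n" for r p
    by (auto simp: cylinder_def)
  ultimately show ?thesis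
    unfolding Lambda_top_def topology_generated_by_topspace by blast
qed

text \<open>The sets of classes with prescribed closed words up to length \<open>r\<close> are neighbourhood bases, so
  the topology is that of pointwise convergence of stabilizers.\<close>

lemma openin_Lambda_iff:
  "openin (Lambda_top n) U \<longleftrightarrow> U \<subseteq> Lambda n \<and>
     (\<forall>G x. schreier_graph n G \<and> x \<in> verts G \<and> rclass n (G, x) \<in> U \<longrightarrow>
       (\<exists>r. \<forall>G' x'. schreier_graph n G' \<and> x' \<in> verts G' \<and> same_loops n r G x G' x' \<longrightarrow>
         rclass n (G', x') \<in> U))" (is "_ \<longleftrightarrow> _ \<and> ?loc U")
proof
  assume U: "openin (Lambda_top n) U"
  then have "U \<subseteq> Lambda n"
    using openin_subset by fastforce
  moreover have "generate_topology_on {cylinder n r p | r p. p \<in> rooted_schreier n} U"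
    using U by (simp add: Lambda_top_def openin_topology_generated_by_iff)
  then have "?loc U"
  proof induction
    case (Int A B)
    show ?case
    proof (intro allI impI)
      fix G :: "nat lgraph" and x
      assume "schreier_graph n G \<and> x \<in> verts G \<and> rclass n (G, x) \<in> A \<inter> B"
      then obtain r s where
        "\<forall>G' x'. schreier_graph n G' \<and> x' \<in> verts G' \<and> same_loops n r G x G' x' \<longrightarrow> rclass n (G', x') \<in> A"
        "\<forall>G' x'. schreier_graph n G' \<and> x' \<in> verts G' \<and> same_loops n s G x G' x' \<longrightarrow> rclass n (G', x') \<in> B"
        using Int.IH by blast
      then show "\<exists>r. \<forall>G' x'. schreier_graph n G' \<and> x' \<in> verts G' \<and> same_loops n r G x G' x' \<longrightarrow>
          rclass n (G', x') \<in> A \<inter> B"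
        by (intro exI[of _ "max r s"]) (meson IntI max.cobounded1 max.cobounded2 same_loops_mono)
    qed
  next
    case (UN K)
    show ?case
    proof (intro allI impI)
      fix G :: "nat lgraph" and x
      assume "schreier_graph n G \<and> x \<in> verts G \<and> rclass n (G, x) \<in> \<Union>K"
      then obtain k where "k \<in> K" "schreier_graph n G \<and> x \<in> verts G \<and> rclass n (G, x) \<in> k" by blast
      then show "\<exists>r. \<forall>G' x'. schreier_graph n G' \<and> x' \<in> verts G' \<and> same_loops n r G x G' x' \<longrightarrow>
          rclass n (G', x') \<in> \<Union>K"
        using UN.IH[of k] by (meson UnionI)
    qed
  next
    case (Basis s)
    then obtain r G0 x0 where s: "s = cylinder n r (G0, x0)" by auto
    show ?case
    proof (intro allI impI)
      fix G :: "nat lgraph" and x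
      assume *: "schreier_graph n G \<and> x \<in> verts G \<and> rclass n (G, x) \<in> s"
      then have G: "schreier_graph n G" "x \<in> verts G"
        and iso: "rooted_isomorphic (nbhd r G x, x) (nbhd r G0 x0, x0)"
        by (auto simp: s rclass_mem_cylinder_iff)
      show "\<exists>r. \<forall>G' x'. schreier_graph n G' \<and> x' \<in> verts G' \<and> same_loops n r G x G' x' \<longrightarrow>
          rclass n (G', x') \<in> s"
      proof (intro exI[of _ "2 * r + 1"] allI impI)
        fix G' :: "nat lgraph" and x'
        assume "schreier_graph n G' \<and> x' \<in> verts G' \<and> same_loops n (2 * r + 1) G x G' x'"
        then have G': "schreier_graph n G'" "x' \<in> verts G'" and l: "same_loops n (2 * r + 1) G' x' G x"
          by (auto intro: same_loops_sym)
        show "rclass n (G', x') \<in> s"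
          unfolding s rclass_mem_cylinder_iff[OF G']
          using rooted_isomorphic_nbhd_if_same_loops[OF G' G l] iso by (rule rooted_isomorphic_trans)
      qed
    qed
  qed simp
  ultimately show "U \<subseteq> Lambda n \<and> ?loc U" ..
next
  assume U: "U \<subseteq> Lambda n \<and> ?loc U"
  have "\<exists>T. openin (Lambda_top n) T \<and> c \<in> T \<and> T \<subseteq> U" if c: "c \<in> U" for c
  proof -
    have "c \<in> Lambda n"
      using c U by auto
    then obtain G x where G: "schreier_graph n G" "x \<in> verts G" and c_eq: "c = rclass n (G, x)"
      by (rule LambdaE)
    then obtain r where r: "\<And>G' x'. schreier_graph n G' \<Longrightarrow> x' \<in> verts G' \<Longrightarrow>
        same_loops n r G x G' x' \<Longrightarrow> rclass n (G', x') \<in> U"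
      using U c by metis
    have "cylinder n r (G, x) \<subseteq> U"
    proof
      fix c' assume c': "c' \<in> cylinder n r (G, x)"
      then have "c' \<in> Lambda n"
        by (auto simp: cylinder_def)
      then obtain G' x' where G': "schreier_graph n G'" "x' \<in> verts G'" "c' = rclass n (G', x')"
        by (rule LambdaE)
      then have "same_loops n r G' x' G x"
        using c' by (intro same_loops_if_rooted_isomorphic_nbhd G) (auto simp: rclass_mem_cylinder_iff)
      then show "c' \<in> U"
        using r[OF G'(1,2)] G'(3) by (simp add: same_loops_sym)
    qed
    moreover have "c \<in> cylinder n r (G, x)"
      using G by (simp add: c_eq rclass_mem_cylinder_iff rooted_isomorphic_refl)
    moreover have "openin (Lambda_top n) (cylinder n r (G, x))"
      unfolding Lambda_top_def using G by (intro topology_generated_by_Basis) auto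
    ultimately show ?thesis
      by blast
  qed
  then show "openin (Lambda_top n) U"
    by (subst openin_subopen) blast
qed

lemma openin_LambdaE:
  assumes "openin (Lambda_top n) U" "schreier_graph n G" "x \<in> verts G" "rclass n (G, x) \<in> U"
  obtains r where "\<And>G' x'. schreier_graph n G' \<Longrightarrow> x' \<in> verts G' \<Longrightarrow>
    same_loops n r G x G' x' \<Longrightarrow> rclass n (G', x') \<in> U"
  using assms unfolding openin_Lambda_iff by blast

text \<open>Distinct classes have distinct stabilizers, hence are separated by whether a single word is
  closed. The Hausdorff property makes the graphs of the maps \<open>move_root g\<close> closed, hence Borel.\<close>

lemma Hausdorff_Lambda_top: "Hausdorff_space (Lambda_top n)"
  unfolding Hausdorff_space_def topspace_Lambda_top
proof (intro allI impI)
  fix c d assume "c \<in> Lambda n \<and> d \<in> Lambda n \<and> c \<noteq> d"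
  then have "c \<in> Lambda n" "d \<in> Lambda n" and neq: "c \<noteq> d" by auto
  obtain G x where G: "schreier_graph n G" "x \<in> verts G" and c: "c = rclass n (G, x)"
    using \<open>c \<in> Lambda n\<close> by (rule LambdaE)
  obtain D y where D: "schreier_graph n D" "y \<in> verts D" and d: "d = rclass n (D, y)"
    using \<open>d \<in> Lambda n\<close> by (rule LambdaE)
  have "stabilizer n G x \<noteq> stabilizer n D y"
    using rclass_eq_if_stabilizer_eq[OF G D] neq c d by blast
  then obtain g where g: "g \<in> carrier (free_group n)" "(walk G x g = x) \<noteq> (walk D y g = y)"
    by (auto simp: stabilizer_def)
  \<comment> \<open>All classes with the same closed words as \<open>(G0, x0)\<close> up to the length of the separating word.\<close>
  define V where "V G0 x0 = {c. \<exists>G' x'. schreier_graph n G' \<and> x' \<in> verts G' \<and>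
      same_loops n (length g) G0 x0 G' x' \<and> c = rclass n (G', x')}" for G0 :: "nat lgraph" and x0
  have mem_V: "rclass n (G', x') \<in> V G0 x0 \<longleftrightarrow> same_loops n (length g) G0 x0 G' x'"
    if G': "schreier_graph n G'" "x' \<in> verts G'" for G0 x0 G' x'
  proof
    assume "rclass n (G', x') \<in> V G0 x0"
    then obtain G'' x'' where G'': "schreier_graph n G''" "x'' \<in> verts G''"
      "same_loops n (length g) G0 x0 G'' x''" "rclass n (G', x') = rclass n (G'', x'')"
      by (auto simp: V_def)
    then have "rooted_isomorphic (G'', x'') (G', x')"
      using rclass_eq_iff[OF G''(1,2) G'] by simp
    then show "same_loops n (length g) G0 x0 G' x'"
      using same_loops_trans[OF G''(3) same_loops_if_rooted_isomorphic[OF G''(1,2) G'(1)]] by blast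
  qed (use G' in \<open>auto simp: V_def\<close>)
  have open_V: "openin (Lambda_top n) (V G0 x0)" for G0 x0
    unfolding openin_Lambda_iff
  proof (intro conjI allI impI)
    show "V G0 x0 \<subseteq> Lambda n"
      by (auto simp: V_def)
    fix G :: "nat lgraph" and x assume "schreier_graph n G \<and> x \<in> verts G \<and> rclass n (G, x) \<in> V G0 x0"
    then show "\<exists>r. \<forall>G' x'. schreier_graph n G' \<and> x' \<in> verts G' \<and> same_loops n r G x G' x' \<longrightarrow>
        rclass n (G', x') \<in> V G0 x0"
      by (intro exI[of _ "length g"]) (auto simp: mem_V intro: same_loops_trans)
  qed
  have "disjnt (V G x) (V D y)"
  proof -
    have False if e: "e \<in> V G x" "e \<in> V D y" for e
    proof -
      obtain G' x' where "schreier_graph n G'" "x' \<in> verts G'" "e = rclass n (G', x')"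
        using e(1) by (auto simp: V_def)
      then have "same_loops n (length g) G x G' x'" "same_loops n (length g) D y G' x'"
        using e mem_V by auto
      then show False
        using g by (auto simp: same_loops_def carrier_free_group)
    qed
    then show ?thesis
      by (auto simp: disjnt_def)
  qed
  moreover have "c \<in> V G x" "d \<in> V D y"
    using G D by (simp_all add: c d mem_V same_loops_refl)
  ultimately show "\<exists>U V. openin (Lambda_top n) U \<and> openin (Lambda_top n) V \<and> c \<in> U \<and> d \<in> V \<and> disjnt U V"
    using open_V by blast
qed

lemma continuous_map_move_root:
  assumes w: "set w \<subseteq> letters n"
  shows "continuous_map (Lambda_top n) (Lambda_top n) (move_root w)"
  unfolding continuous_map_def
proof (intro conjI allI impI)
  show "move_root w \<in> topspace (Lambda_top n) \<rightarrow> topspace (Lambda_top n)"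
    using move_root_Lambda w by auto
  fix U assume U: "openin (Lambda_top n) U"
  have eq: "rclass n (G, x) \<in> {c \<in> topspace (Lambda_top n). move_root w c \<in> U} \<longleftrightarrow>
      rclass n (G, walk G x w) \<in> U" if "schreier_graph n G" "x \<in> verts G" for G x
    using that w by (simp add: move_root_rclass)
  show "openin (Lambda_top n) {c \<in> topspace (Lambda_top n). move_root w c \<in> U}"
    unfolding openin_Lambda_iff
  proof (intro conjI allI impI)
    fix G :: "nat lgraph" and x
    assume "schreier_graph n G \<and> x \<in> verts G \<and>
        rclass n (G, x) \<in> {c \<in> topspace (Lambda_top n). move_root w c \<in> U}"
    then have G: "schreier_graph n G" "x \<in> verts G" and "rclass n (G, walk G x w) \<in> U"
      using eq by blast+
    then obtain r where r: "\<And>G' x'. schreier_graph n G' \<Longrightarrow> x' \<in> verts G' \<Longrightarrow>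
        same_loops n r G (walk G x w) G' x' \<Longrightarrow> rclass n (G', x') \<in> U"
      using openin_LambdaE[OF U G(1) walk_verts[OF G w]] by blast
    show "\<exists>r. \<forall>G' x'. schreier_graph n G' \<and> x' \<in> verts G' \<and> same_loops n r G x G' x' \<longrightarrow>
        rclass n (G', x') \<in> {c \<in> topspace (Lambda_top n). move_root w c \<in> U}"
    proof (intro exI[of _ "r + 2 * length w"] allI impI)
      fix G' :: "nat lgraph" and x'
      assume "schreier_graph n G' \<and> x' \<in> verts G' \<and> same_loops n (r + 2 * length w) G x G' x'"
      then have G': "schreier_graph n G'" "x' \<in> verts G'"
        and loops: "same_loops n (r + 2 * length w) G x G' x'" by auto
      show "rclass n (G', x') \<in> {c \<in> topspace (Lambda_top n). move_root w c \<in> U}"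
        unfolding eq[OF G'] by (rule r[OF G'(1) walk_verts[OF G' w] same_loops_walk[OF G G' loops w]])
    qed
  qed simp
qed

section \<open>The space of doubly rooted Schreier graphs\<close>

lemma topspace_Lambda2_top [simp]: "topspace (Lambda2_top n) = Lambda2 n"
proof -
  have "d \<in> \<Union>{cylinder2 n r (G, x, y) | r G x y. (G, x, y) \<in> birooted_schreier n \<and> y \<in> ball_verts G x r}"
    if d: "d \<in> Lambda2 n" for d
  proof -
    obtain G x y where G: "schreier_graph n G" "x \<in> verts G" "y \<in> verts G" "d = bclass n (G, x, y)"
      using d by (rule Lambda2E)
    obtain g where "g \<in> carrier (free_group n)" "walk G x g = y"
      using schreier_connected[OF G(1-3)] .
    then have y: "y \<in> ball_verts G x (length g)"
      unfolding ball_verts_iff_walk[OF G(1,2)] carrier_free_group by blast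
    then have "d \<in> cylinder2 n (length g) (G, x, y)"
      using G by (simp add: bclass_mem_cylinder2_iff birooted_isomorphic_refl)
    moreover have "(G, x, y) \<in> birooted_schreier n"
      using G by simp
    ultimately show ?thesis
      using y by blast
  qed
  moreover have "cylinder2 n r p \<subseteq> Lambda2 n" for r p
    by (auto simp: cylinder2_def split: prod.splits)
  ultimately show ?thesis
    unfolding Lambda2_top_def topology_generated_by_topspace by blast
qed

text \<open>The section, over the rooted graphs, of the doubly rooted graphs whose secondary root is reached
  from the principal one by \<open>w\<close>.\<close>

definition add_root :: "letter list \<Rightarrow> rooted_class \<Rightarrow> birooted_class" where
  "add_root w c = (\<lambda>(G, x). (G, x, walk G x w)) ` c"

lemma add_root_rclass:
  assumes G: "schreier_graph n G" "x \<in> verts G" and w: "set w \<subseteq> letters n"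
  shows "add_root w (rclass n (G, x)) = bclass n (G, x, walk G x w)"
proof (intro equalityI subrelI)
  fix G' p
  assume "(G', p) \<in> add_root w (rclass n (G, x))"
  then obtain x' where x': "schreier_graph n G'" "x' \<in> verts G'" "rooted_isomorphic (G, x) (G', x')"
    "p = (x', walk G' x' w)"
    by (auto simp: add_root_def mem_rclass)
  then obtain f where "lgraph_iso f G G'" "f x = x'"
    by (auto simp: rooted_isomorphic_def)
  then show "(G', p) \<in> bclass n (G, x, walk G x w)"
    using x' G w lgraph_iso_walk[of n G G' f x w]
    by (auto simp: mem_bclass walk_verts birooted_isomorphic_def)
next
  fix G' p
  assume *: "(G', p) \<in> bclass n (G, x, walk G x w)"
  obtain x' y' where p: "p = (x', y')" by (cases p)
  obtain f where z: "schreier_graph n G'" "x' \<in> verts G'" "lgraph_iso f G G'" "f x = x'" "f (walk G x w) = y'"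
    using * by (auto simp: p mem_bclass birooted_isomorphic_def)
  then have "(G', x') \<in> rclass n (G, x)" "y' = walk G' x' w"
    using G w lgraph_iso_walk[of n G G' f x w]
    by (auto simp: mem_rclass rooted_isomorphic_def)
  then show "(G', p) \<in> add_root w (rclass n (G, x))"
    by (force simp: add_root_def p)
qed

lemma pi_x_bclass:
  assumes G: "schreier_graph n G" "x \<in> verts G" "y \<in> verts G"
  shows "pi_x (bclass n (G, x, y)) = rclass n (G, x)"
proof (intro equalityI subrelI)
  fix G' x'
  assume "(G', x') \<in> pi_x (bclass n (G, x, y))"
  then show "(G', x') \<in> rclass n (G, x)"
    by (auto simp: pi_x_def mem_bclass mem_rclass rooted_isomorphic_def birooted_isomorphic_def)
next
  fix G' x'
  assume "(G', x') \<in> rclass n (G, x)"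
  then obtain f where f: "schreier_graph n G'" "x' \<in> verts G'" "lgraph_iso f G G'" "f x = x'"
    by (auto simp: mem_rclass rooted_isomorphic_def)
  then have "(G', x', f y) \<in> bclass n (G, x, y)"
    using G by (auto simp: mem_bclass birooted_isomorphic_def lgraph_iso_verts)
  then show "(G', x') \<in> pi_x (bclass n (G, x, y))"
    by (force simp: pi_x_def)
qed

lemma pi_y_bclass:
  assumes G: "schreier_graph n G" "x \<in> verts G" "y \<in> verts G"
  shows "pi_y (bclass n (G, x, y)) = rclass n (G, y)"
proof (intro equalityI subrelI)
  fix G' y'
  assume "(G', y') \<in> pi_y (bclass n (G, x, y))"
  then show "(G', y') \<in> rclass n (G, y)"
    by (auto simp: pi_y_def mem_bclass mem_rclass rooted_isomorphic_def birooted_isomorphic_def)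
next
  fix G' y'
  assume "(G', y') \<in> rclass n (G, y)"
  then obtain f where f: "schreier_graph n G'" "y' \<in> verts G'" "lgraph_iso f G G'" "f y = y'"
    by (auto simp: mem_rclass rooted_isomorphic_def)
  then have "(G', f x, y') \<in> bclass n (G, x, y)"
    using G by (auto simp: mem_bclass birooted_isomorphic_def lgraph_iso_verts)
  then show "(G', y') \<in> pi_y (bclass n (G, x, y))"
    by (force simp: pi_y_def)
qed

lemma pi_add_root:
  assumes "c \<in> Lambda n" "set w \<subseteq> letters n"
  shows "add_root w c \<in> Lambda2 n" "pi_x (add_root w c) = c" "pi_y (add_root w c) = move_root w c"
  using assms
  by (auto elim!: LambdaE simp: add_root_rclass pi_x_bclass pi_y_bclass move_root_rclass walk_verts)

lemma Lambda2_eq_UN_add_root: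
  "Lambda2 n = (\<Union>g\<in>carrier (free_group n). add_root g ` Lambda n)"
proof (intro equalityI subsetI)
  fix d assume "d \<in> Lambda2 n"
  then obtain G x y where G: "schreier_graph n G" "x \<in> verts G" "y \<in> verts G" "d = bclass n (G, x, y)"
    by (rule Lambda2E)
  obtain g where g: "g \<in> carrier (free_group n)" "walk G x g = y"
    using schreier_connected[OF G(1-3)] .
  then have "d = add_root g (rclass n (G, x))"
    using G by (simp add: add_root_rclass carrier_free_group)
  moreover have "rclass n (G, x) \<in> Lambda n"
    using G by simp
  ultimately show "d \<in> (\<Union>g\<in>carrier (free_group n). add_root g ` Lambda n)"
    using g(1) by (intro UN_I image_eqI)
qed (auto simp: pi_add_root carrier_free_group)

lemma bclass_mem_add_root_iff:
  assumes G: "schreier_graph n G" "x \<in> verts G" "y \<in> verts G" and w: "set w \<subseteq> letters n"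
  shows "bclass n (G, x, y) \<in> add_root w ` Lambda n \<longleftrightarrow> walk G x w = y"
proof
  assume "bclass n (G, x, y) \<in> add_root w ` Lambda n"
  then obtain c where c: "c \<in> Lambda n" "bclass n (G, x, y) = add_root w c" by blast
  then have "c = rclass n (G, x)"
    using pi_add_root(2)[OF c(1) w] pi_x_bclass[OF G] by simp
  then have "bclass n (G, x, y) = bclass n (G, x, walk G x w)"
    using c(2) add_root_rclass[OF G(1,2) w] by simp
  then obtain f where f: "lgraph_iso f G G" "f x = x" "f y = walk G x w"
    using bclass_eq_iff[OF G(1-3) G(1,2) walk_verts[OF G(1,2) w]] by (auto simp: birooted_isomorphic_def)
  have "f (walk G x w) = f y"
    using lgraph_iso_walk[OF G(1) G(1) f(1) G(2) w] f by simp
  then show "walk G x w = y"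
    using lgraph_iso_inj[OF f(1) walk_verts[OF G(1,2) w] G(3)] by simp
next
  assume "walk G x w = y"
  then show "bclass n (G, x, y) \<in> add_root w ` Lambda n"
    using add_root_rclass[OF G(1,2) w] G by (metis image_eqI rclass_in_Lambda)
qed

lemma openin_cylinder2:
  assumes "schreier_graph n G" "x \<in> verts G" "y \<in> verts G" "y \<in> ball_verts G x r"
  shows "openin (Lambda2_top n) (cylinder2 n r (G, x, y))"
  unfolding Lambda2_top_def using assms by (intro topology_generated_by_Basis) auto

lemma mem_own_cylinder2:
  assumes "schreier_graph n G" "x \<in> verts G" "y \<in> verts G" "y \<in> ball_verts G x r"
  shows "bclass n (G, x, y) \<in> cylinder2 n r (G, x, y)"
  using assms by (simp add: bclass_mem_cylinder2_iff birooted_isomorphic_refl)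

text \<open>Whether \<open>w\<close> leads from the principal root to the secondary one is visible in the neighbourhood
  of radius \<open>length w\<close>.\<close>

lemma openin_add_root_image:
  assumes w: "set w \<subseteq> letters n"
  shows "openin (Lambda2_top n) (add_root w ` Lambda n)"
proof (subst openin_subopen, rule ballI)
  fix d assume d: "d \<in> add_root w ` Lambda n"
  then have "d \<in> Lambda2 n"
    using pi_add_root w by auto
  then obtain G x y where G: "schreier_graph n G" "x \<in> verts G" "y \<in> verts G" and d_eq: "d = bclass n (G, x, y)"
    by (rule Lambda2E)
  have y: "walk G x w = y"
    using d bclass_mem_add_root_iff[OF G w] d_eq by simp
  then have ball: "y \<in> ball_verts G x (length w)"
    unfolding ball_verts_iff_walk[OF G(1,2)] using w by blast
  have "cylinder2 n (length w) (G, x, y) \<subseteq> add_root w ` Lambda n"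
  proof
    fix e assume e: "e \<in> cylinder2 n (length w) (G, x, y)"
    then have "e \<in> Lambda2 n"
      by (auto simp: cylinder2_def)
    then obtain G' x' y' where G': "schreier_graph n G'" "x' \<in> verts G'" "y' \<in> verts G'" "e = bclass n (G', x', y')"
      by (rule Lambda2E)
    then have "y' \<in> ball_verts G' x' (length w)"
      and "birooted_isomorphic (nbhd (length w) G' x', x', y') (nbhd (length w) G x, x, y)"
      using e bclass_mem_cylinder2_iff[OF G'(1-3)] by auto
    then obtain f where f: "lgraph_iso f (nbhd (length w) G' x') (nbhd (length w) G x)" "f x' = x" "f y' = y"
      and y': "y' \<in> verts (nbhd (length w) G' x')"
      by (auto simp: birooted_isomorphic_def)
    have "walk G' x' w \<in> verts (nbhd (length w) G' x')"
      unfolding verts_nbhd ball_verts_iff_walk[OF G'(1,2)] using w by blast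
    moreover have "f (walk G' x' w) = f y'"
      using lgraph_iso_nbhd_walk[OF G'(1,2) G(1,2) f(1,2) w] f(3) y by simp
    ultimately have "walk G' x' w = y'"
      using lgraph_iso_inj[OF f(1)] y' by blast
    then show "e \<in> add_root w ` Lambda n"
      using bclass_mem_add_root_iff[OF G'(1-3) w] G'(4) by simp
  qed
  then show "\<exists>T. openin (Lambda2_top n) T \<and> d \<in> T \<and> T \<subseteq> add_root w ` Lambda n"
    using openin_cylinder2[OF G ball] mem_own_cylinder2[OF G ball] unfolding d_eq by blast
qed

lemma continuous_map_pi_x: "continuous_map (Lambda2_top n) (Lambda_top n) pi_x"
  unfolding continuous_map_def
proof (intro conjI allI impI)
  show "pi_x \<in> topspace (Lambda2_top n) \<rightarrow> topspace (Lambda_top n)"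
    by (auto elim!: Lambda2E simp: pi_x_bclass)
  fix U assume U: "openin (Lambda_top n) U"
  show "openin (Lambda2_top n) {d \<in> topspace (Lambda2_top n). pi_x d \<in> U}"
  proof (subst openin_subopen, rule ballI)
    fix d assume d: "d \<in> {d \<in> topspace (Lambda2_top n). pi_x d \<in> U}"
    then have "d \<in> Lambda2 n" by simp
    then obtain G x y where G: "schreier_graph n G" "x \<in> verts G" "y \<in> verts G"
      and d_eq: "d = bclass n (G, x, y)"
      by (rule Lambda2E)
    have "rclass n (G, x) \<in> U"
      using d pi_x_bclass[OF G] d_eq by simp
    then obtain r where r: "\<And>G' x'. schreier_graph n G' \<Longrightarrow> x' \<in> verts G' \<Longrightarrow>
        same_loops n r G x G' x' \<Longrightarrow> rclass n (G', x') \<in> U"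
      using openin_LambdaE[OF U G(1,2)] by blast
    obtain g where g: "g \<in> carrier (free_group n)" "walk G x g = y"
      using schreier_connected[OF G] .
    \<comment> \<open>A cylinder has to contain the secondary root, so the radius may have to grow.\<close>
    define s where "s = max r (length g)"
    have ball: "y \<in> ball_verts G x s"
      unfolding ball_verts_iff_walk[OF G(1,2)] s_def using g by (metis carrier_free_group max.cobounded2)
    have "cylinder2 n s (G, x, y) \<subseteq> {d \<in> topspace (Lambda2_top n). pi_x d \<in> U}"
    proof
      fix e assume e: "e \<in> cylinder2 n s (G, x, y)"
      then have e2: "e \<in> Lambda2 n"
        by (auto simp: cylinder2_def)
      then obtain G' x' y' where G': "schreier_graph n G'" "x' \<in> verts G'" "y' \<in> verts G'" "e = bclass n (G', x', y')"
        by (rule Lambda2E)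
      then have "birooted_isomorphic (nbhd s G' x', x', y') (nbhd s G x, x, y)"
        using e bclass_mem_cylinder2_iff[OF G'(1-3)] by auto
      then have "rooted_isomorphic (nbhd s G' x', x') (nbhd s G x, x)"
        by (auto simp: birooted_isomorphic_def rooted_isomorphic_def)
      then have "same_loops n s G x G' x'"
        using same_loops_sym[OF same_loops_if_rooted_isomorphic_nbhd[OF G'(1,2) G(1,2)]] by blast
      then have "rclass n (G', x') \<in> U"
        using r[OF G'(1,2)] same_loops_mono[of n s G x G' x' r] by (simp add: s_def)
      then show "e \<in> {d \<in> topspace (Lambda2_top n). pi_x d \<in> U}"
        using e2 pi_x_bclass[OF G'(1-3)] G'(4) by simp
    qed
    then show "\<exists>T. openin (Lambda2_top n) T \<and> d \<in> T \<and> T \<subseteq> {d \<in> topspace (Lambda2_top n). pi_x d \<in> U}"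
      using openin_cylinder2[OF G ball] mem_own_cylinder2[OF G ball] unfolding d_eq by blast
  qed
qed

text \<open>A cylinder of radius \<open>r\<close> asks in addition that \<open>w\<close> ends at a given vertex of the
  \<open>r\<close>-neighbourhood. That vertex is reached by a word of length at most \<open>r\<close>, so this is a condition
  on a closed word of length at most \<open>r + length w\<close>.\<close>

lemma continuous_map_add_root:
  assumes w: "set w \<subseteq> letters n"
  shows "continuous_map (Lambda_top n) (Lambda2_top n) (add_root w)"
  unfolding Lambda2_top_def continuous_on_generated_topo_iff
proof (intro conjI allI impI)
  show "add_root w ` topspace (Lambda_top n) \<subseteq>
      \<Union> {cylinder2 n r (G, x, y) | r G x y. (G, x, y) \<in> birooted_schreier n \<and> y \<in> ball_verts G x r}"
    using pi_add_root(1)[OF _ w] topspace_Lambda2_top[of n]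
    unfolding Lambda2_top_def topology_generated_by_topspace by auto
  fix U assume "U \<in> {cylinder2 n r (G, x, y) | r G x y. (G, x, y) \<in> birooted_schreier n \<and> y \<in> ball_verts G x r}"
  then obtain r G0 x0 y0 where U: "U = cylinder2 n r (G0, x0, y0)" by blast
  have eq: "rclass n (G, x) \<in> add_root w -` U \<inter> topspace (Lambda_top n) \<longleftrightarrow>
      walk G x w \<in> ball_verts G x r \<and>
      birooted_isomorphic (nbhd r G x, x, walk G x w) (nbhd r G0 x0, x0, y0)"
    if "schreier_graph n G" "x \<in> verts G" for G x
    using that w walk_verts[OF that w] by (simp add: U add_root_rclass bclass_mem_cylinder2_iff)
  show "openin (Lambda_top n) (add_root w -` U \<inter> topspace (Lambda_top n))"
    unfolding openin_Lambda_iff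
  proof (intro conjI allI impI)
    fix G :: "nat lgraph" and x
    assume *: "schreier_graph n G \<and> x \<in> verts G \<and> rclass n (G, x) \<in> add_root w -` U \<inter> topspace (Lambda_top n)"
    then have G: "schreier_graph n G" "x \<in> verts G" by auto
    then have ball: "walk G x w \<in> ball_verts G x r"
      and iso: "birooted_isomorphic (nbhd r G x, x, walk G x w) (nbhd r G0 x0, x0, y0)"
      using * eq by auto
    obtain u where u: "set u \<subseteq> letters n" "length u \<le> r" "walk G x u = walk G x w"
      using ball unfolding ball_verts_iff_walk[OF G] by blast
    show "\<exists>r. \<forall>G' x'. schreier_graph n G' \<and> x' \<in> verts G' \<and> same_loops n r G x G' x' \<longrightarrow>
        rclass n (G', x') \<in> add_root w -` U \<inter> topspace (Lambda_top n)"
    proof (intro exI[of _ "2 * r + 1 + length w"] allI impI)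
      fix G' :: "nat lgraph" and x'
      assume a: "schreier_graph n G' \<and> x' \<in> verts G' \<and> same_loops n (2 * r + 1 + length w) G x G' x'"
      then have G': "schreier_graph n G'" "x' \<in> verts G'" and loops: "same_loops n (2 * r + 1 + length w) G x G' x'"
        by auto
      have u': "walk G' x' u = walk G' x' w"
        using same_loops_walk_eq[OF G G' loops u(1) w] u by simp
      then have "walk G' x' w \<in> ball_verts G' x' r"
        unfolding ball_verts_iff_walk[OF G'] using u by blast
      moreover have "same_loops n (2 * r + 1) G' x' G x"
        using same_loops_sym[OF same_loops_mono[OF loops]] by simp
      then have "birooted_isomorphic (nbhd r G' x', x', walk G' x' w) (nbhd r G x, x, walk G x w)"
        using birooted_isomorphic_nbhd_if_same_loops[OF G' G _ u(1,2)] u(3) u' by simp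
      then have "birooted_isomorphic (nbhd r G' x', x', walk G' x' w) (nbhd r G0 x0, x0, y0)"
        using iso by (rule birooted_isomorphic_trans)
      ultimately show "rclass n (G', x') \<in> add_root w -` U \<inter> topspace (Lambda_top n)"
        using eq[OF G'] by blast
    qed
  qed simp
qed

text \<open>An automorphism that fixes \<open>x\<close> fixes the endpoint of every walk from \<open>x\<close>.\<close>

lemma stab_orbit_trivial:
  assumes G: "schreier_graph n G" "x \<in> verts G" "y \<in> verts G"
  shows "stab_orbit G x y = {y}"
proof -
  have "f y = y" if f: "lgraph_iso f G G" "f x = x" for f
  proof -
    obtain g where g: "g \<in> carrier (free_group n)" "walk G x g = y"
      using schreier_connected[OF G] .
    then show ?thesis
      using lgraph_iso_walk[OF G(1) G(1) f(1) G(2), of g] f(2) by (simp add: carrier_free_group)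
  qed
  moreover have "y \<in> stab_orbit G x y"
    using lgraph_iso_id[of G] by (auto simp: stab_orbit_def intro!: exI[of _ id])
  ultimately show ?thesis
    by (auto simp: stab_orbit_def)
qed

lemma mass_eq_1:
  assumes "d \<in> Lambda2 n"
  shows "mass_x d = 1" "mass_y d = 1"
proof -
  obtain G x y where "schreier_graph n G" "x \<in> verts G" "y \<in> verts G" "d = bclass n (G, x, y)"
    using assms by (rule Lambda2E)
  then have "(G, x, y) \<in> d"
    by (simp add: mem_bclass birooted_isomorphic_refl)
  then have some: "(SOME t. t \<in> d) \<in> d"
    by (rule someI)
  obtain G' x' y' where t: "(SOME t. t \<in> d) = (G', x', y')"
    by (metis prod_cases3)
  have "schreier_graph n G'" "x' \<in> verts G'" "y' \<in> verts G'"
    using bclass_of_member[OF assms] some t by auto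
  then show "mass_x d = 1" "mass_y d = 1"
    by (simp_all add: mass_x_def mass_y_def t stab_orbit_trivial ecard_def)
qed

section \<open>Counting along the graphs of countably many maps\<close>

lemma ecard_empty: "ecard {} = 0"
  by (simp add: ecard_def)

lemma ecard_singleton: "ecard {x} = 1"
  by (simp add: ecard_def)

text \<open>The piece \<open>s i ` space M\<close> of \<open>N\<close> is the graph of the bijection \<open>T i\<close> of \<open>M\<close>, whose inverse is
  \<open>T' i\<close>; the pieces may overlap.\<close>

locale countable_cover =
  fixes M :: "'a measure" and N :: "'b measure" and I :: "'i set"
    and s :: "'i \<Rightarrow> 'a \<Rightarrow> 'b" and T :: "'i \<Rightarrow> 'a \<Rightarrow> 'a" and T' :: "'i \<Rightarrow> 'a \<Rightarrow> 'a" and p q :: "'b \<Rightarrow> 'a"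
  assumes countable_I: "countable I" and I_nonempty: "I \<noteq> {}"
    and space_N: "space N = (\<Union>i\<in>I. s i ` space M)"
    and section_measurable: "i \<in> I \<Longrightarrow> s i \<in> measurable M N"
    and image_measurable: "i \<in> I \<Longrightarrow> s i ` space M \<in> sets N"
    and p_measurable: "p \<in> measurable N M"
    and p_section: "i \<in> I \<Longrightarrow> c \<in> space M \<Longrightarrow> p (s i c) = c"
    and q_section: "i \<in> I \<Longrightarrow> c \<in> space M \<Longrightarrow> q (s i c) = T i c"
    and T_measurable: "i \<in> I \<Longrightarrow> T i \<in> measurable M M"
    and T'_measurable: "i \<in> I \<Longrightarrow> T' i \<in> measurable M M"
    and T'_T: "i \<in> I \<Longrightarrow> c \<in> space M \<Longrightarrow> T' i (T i c) = c"
    and T_T': "i \<in> I \<Longrightarrow> c \<in> space M \<Longrightarrow> T i (T' i c) = c"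
begin

text \<open>On a subset of a single piece both projections are injective, and the two counts are the
  indicators of \<open>s i -` A\<close> and of its image under \<open>T i\<close>.\<close>

lemma ecard_p_fiber:
  assumes "i \<in> I" "A \<subseteq> s i ` space M" "c \<in> space M"
  shows "ecard {d \<in> A. p d = c} = indicator (s i -` A \<inter> space M) c"
proof -
  have "{d \<in> A. p d = c} = (if s i c \<in> A then {s i c} else {})"
    using assms p_section by auto
  then show ?thesis
    using assms(3) by (simp add: ecard_singleton ecard_empty indicator_def)
qed

lemma ecard_q_fiber:
  assumes "i \<in> I" "A \<subseteq> s i ` space M" "c \<in> space M"
  shows "ecard {d \<in> A. q d = c} = indicator (T' i -` (s i -` A \<inter> space M) \<inter> space M) c"
proof -
  have T': "T' i c \<in> space M"
    using measurable_space[OF T'_measurable[OF assms(1)] assms(3)] .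
  have "{d \<in> A. q d = c} = (if s i (T' i c) \<in> A then {s i (T' i c)} else {})"
    using assms q_section T'_T T_T' T' by auto
  then show ?thesis
    using assms(3) T' by (simp add: ecard_singleton ecard_empty indicator_def)
qed

lemma emeasure_T'_vimage:
  assumes inv: "\<And>B. B \<in> sets M \<Longrightarrow> emeasure M (T i -` B \<inter> space M) = emeasure M B"
    and i: "i \<in> I" and X: "X \<in> sets M"
  shows "emeasure M (T' i -` X \<inter> space M) = emeasure M X"
proof -
  have X': "T' i -` X \<inter> space M \<in> sets M"
    using measurable_sets[OF T'_measurable[OF i] X] .
  have "T i -` (T' i -` X \<inter> space M) \<inter> space M = X"
    using T'_T[OF i] measurable_space[OF T_measurable[OF i]] sets.sets_into_space[OF X] by auto
  then show ?thesis
    using inv[OF X'] by simp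
qed

text \<open>From left to right, \<open>B\<close> is tested on the part of the piece \<open>i\<close> that lies over \<open>T i -` B\<close>: its
  two counts are the measures of \<open>T i -` B\<close> and of \<open>B\<close>. From right to left, \<open>A\<close> is cut along the
  pieces made disjoint, and the counts are summed.\<close>

lemma counts_eq_iff_invariant:
  "(\<forall>A\<in>sets N. (\<integral>\<^sup>+c. ecard {d \<in> A. p d = c} \<partial>M) = (\<integral>\<^sup>+c. ecard {d \<in> A. q d = c} \<partial>M)) \<longleftrightarrow>
   (\<forall>i\<in>I. \<forall>B\<in>sets M. emeasure M (T i -` B \<inter> space M) = emeasure M B)" (is "?counts \<longleftrightarrow> ?inv")
proof (intro iffI ballI)
  fix i B
  assume counts: ?counts and i: "i \<in> I" and B: "B \<in> sets M"
  define X where "X = T i -` B \<inter> space M"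
  define A where "A = s i ` space M \<inter> (p -` X \<inter> space N)"
  have X: "X \<in> sets M"
    unfolding X_def using measurable_sets[OF T_measurable[OF i] B] .
  have A: "A \<in> sets N"
    unfolding A_def using image_measurable[OF i] measurable_sets[OF p_measurable X] by blast
  have pre: "s i -` A \<inter> space M = X"
    using p_section[OF i] measurable_space[OF section_measurable[OF i]]
    by (auto simp: A_def X_def) (metis p_section[OF i])
  have pre': "T' i -` X \<inter> space M = B"
    using T_T'[OF i] measurable_space[OF T'_measurable[OF i]] sets.sets_into_space[OF B]
    by (auto simp: X_def)
  have A_sub: "A \<subseteq> s i ` space M"
    by (simp add: A_def)
  have "emeasure M X = (\<integral>\<^sup>+c. indicator X c \<partial>M)"
    using X by simp
  also have "\<dots> = (\<integral>\<^sup>+c. ecard {d \<in> A. p d = c} \<partial>M)"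
    by (intro nn_integral_cong) (simp only: ecard_p_fiber[OF i A_sub] pre)
  also have "\<dots> = (\<integral>\<^sup>+c. ecard {d \<in> A. q d = c} \<partial>M)"
    using counts A by blast
  also have "\<dots> = (\<integral>\<^sup>+c. indicator B c \<partial>M)"
    by (intro nn_integral_cong) (simp only: ecard_q_fiber[OF i A_sub] pre pre')
  also have "\<dots> = emeasure M B"
    using B by simp
  finally show "emeasure M (T i -` B \<inter> space M) = emeasure M B"
    by (simp add: X_def)
next
  fix A
  assume inv: ?inv and A: "A \<in> sets N"
  define e where "e = from_nat_into I"
  have e: "e k \<in> I" for k
    unfolding e_def using I_nonempty by (rule from_nat_into)
  have range_e: "range e = I"
    unfolding e_def using I_nonempty countable_I by (rule range_from_nat_into)
  \<comment> \<open>The piece \<open>e k\<close> without the earlier pieces.\<close>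
  define D where "D k = A \<inter> disjointed (\<lambda>k. s (e k) ` space M) k" for k
  have D_sub: "D k \<subseteq> s (e k) ` space M" for k
    using disjointed_subset[of "\<lambda>k. s (e k) ` space M" k] by (auto simp: D_def)
  have "range (disjointed (\<lambda>k. s (e k) ` space M)) \<subseteq> sets N"
    using image_measurable e by (intro sets.range_disjointed_sets) auto
  then have D: "D k \<in> sets N" for k
    unfolding D_def using A by blast
  have "(\<Union>k. s (e k) ` space M) = space N"
    unfolding space_N range_e[symmetric] by simp
  then have "(\<Union>k. D k) = A"
    using sets.sets_into_space[OF A]
    by (simp add: D_def UN_disjointed_eq flip: Int_UN_distrib) blast
  then have split: "ecard {d \<in> A. f d = c} = (\<Sum>k. ecard {d \<in> D k. f d = c})" for f :: "'b \<Rightarrow> 'a" and c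
  proof -
    assume UN: "(\<Union>k. D k) = A"
    have "disjoint_family (\<lambda>k. {d \<in> D k. f d = c})"
      using disjoint_family_disjointed[of "\<lambda>k. s (e k) ` space M"]
      by (fastforce simp: D_def disjoint_family_on_def)
    then have "(\<Sum>k. ecard {d \<in> D k. f d = c}) = ecard (\<Union>k. {d \<in> D k. f d = c})"
      unfolding ecard_def by (intro suminf_emeasure) auto
    also have "(\<Union>k. {d \<in> D k. f d = c}) = {d \<in> A. f d = c}"
      using UN by blast
    finally show ?thesis ..
  qed
  have pre: "s (e k) -` D k \<inter> space M \<in> sets M" for k
    using measurable_sets[OF section_measurable[OF e] D] .
  have pre': "T' (e k) -` (s (e k) -` D k \<inter> space M) \<inter> space M \<in> sets M" for k
    using measurable_sets[OF T'_measurable[OF e] pre] .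
  have "(\<integral>\<^sup>+c. ecard {d \<in> A. p d = c} \<partial>M) =
      (\<integral>\<^sup>+c. (\<Sum>k. indicator (s (e k) -` D k \<inter> space M) c) \<partial>M)"
    by (intro nn_integral_cong) (simp only: split ecard_p_fiber[OF e D_sub])
  also have "\<dots> = (\<Sum>k. emeasure M (s (e k) -` D k \<inter> space M))"
    using pre by (simp add: nn_integral_suminf)
  also have "\<dots> = (\<Sum>k. emeasure M (T' (e k) -` (s (e k) -` D k \<inter> space M) \<inter> space M))"
    using emeasure_T'_vimage[OF _ e pre] inv e by simp
  also have "\<dots> = (\<integral>\<^sup>+c. (\<Sum>k. indicator (T' (e k) -` (s (e k) -` D k \<inter> space M) \<inter> space M) c) \<partial>M)"
    using pre' by (simp add: nn_integral_suminf)
  also have "\<dots> = (\<integral>\<^sup>+c. ecard {d \<in> A. q d = c} \<partial>M)"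
    by (intro nn_integral_cong) (simp only: split ecard_q_fiber[OF e D_sub])
  finally show "(\<integral>\<^sup>+c. ecard {d \<in> A. p d = c} \<partial>M) = (\<integral>\<^sup>+c. ecard {d \<in> A. q d = c} \<partial>M)" .
qed

end

section \<open>Invariance, unimodularity and conjugation invariance\<close>

lemma space_borel_of [simp]: "space (borel_of X) = topspace X"
  by (simp add: borel_of_def space_measure_of_conv)

lemma sets_borel_of: "sets (borel_of X) = sigma_sets (topspace X) {U. openin X U}"
  unfolding borel_of_def by (intro sets_measure_of) (auto dest: openin_subset)

lemma openin_sets_borel_of: "openin X U \<Longrightarrow> U \<in> sets (borel_of X)"
  by (auto simp: sets_borel_of)

lemma closedin_sets_borel_of:
  assumes "closedin X C"
  shows "C \<in> sets (borel_of X)"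
proof -
  have "topspace X - (topspace X - C) \<in> sets (borel_of X)"
    using assms sets.compl_sets[OF openin_sets_borel_of, of X "topspace X - C"] by (auto simp: closedin_def)
  then show ?thesis
    using closedin_subset[OF assms] by (simp add: double_diff)
qed

lemma continuous_map_measurable_borel_of:
  assumes "continuous_map X Y f"
  shows "f \<in> measurable (borel_of X) (borel_of Y)"
  unfolding borel_of_def[of Y]
proof (rule measurable_measure_of)
  show "{U. openin Y U} \<subseteq> Pow (topspace Y)"
    by (auto dest: openin_subset)
  show "f \<in> space (borel_of X) \<rightarrow> topspace Y"
    using continuous_map_funspace[OF assms] by simp
  fix U assume "U \<in> {U. openin Y U}"
  then have "openin X {x \<in> topspace X. f x \<in> U}"
    using assms by (auto simp: continuous_map_def)
  moreover have "f -` U \<inter> space (borel_of X) = {x \<in> topspace X. f x \<in> U}"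
    by auto
  ultimately show "f -` U \<inter> space (borel_of X) \<in> sets (borel_of X)"
    by (simp add: openin_sets_borel_of)
qed

text \<open>The common value of the three sets of measures.\<close>

definition move_invariant_measures :: "nat \<Rightarrow> rooted_class measure set" where
  "move_invariant_measures n =
     {\<mu> \<in> prob_measures n. \<forall>g\<in>carrier (free_group n). \<forall>B\<in>sets \<mu>.
        emeasure \<mu> (move_root g -` B \<inter> space \<mu>) = emeasure \<mu> B}"

lemma prob_measuresD:
  assumes "\<mu> \<in> prob_measures n"
  shows "sets \<mu> = sets (borel_of (Lambda_top n))" "space \<mu> = Lambda n"
proof -
  show *: "sets \<mu> = sets (borel_of (Lambda_top n))"
    using assms by (simp add: prob_measures_def)
  show "space \<mu> = Lambda n"
    using sets_eq_imp_space_eq[OF *] by simp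
qed

lemma carrier_letters: "g \<in> carrier (free_group n) \<Longrightarrow> set g \<subseteq> letters n"
  by (simp add: carrier_free_group)

lemma inv_carrier: "g \<in> carrier (free_group n) \<Longrightarrow> inv\<^bsub>free_group n\<^esub> g \<in> carrier (free_group n)"
  by (simp add: group.inv_closed group_free_group)

lemma move_root_measurable:
  assumes "\<mu> \<in> prob_measures n" "g \<in> carrier (free_group n)"
  shows "move_root g \<in> measurable \<mu> \<mu>"
  using continuous_map_measurable_borel_of[OF continuous_map_move_root[OF carrier_letters[OF assms(2)]]]
  unfolding measurable_cong_sets[OF prob_measuresD(1)[OF assms(1)] prob_measuresD(1)[OF assms(1)]] .

lemma conjugation_invariant_eq_move_invariant:
  "conjugation_invariant_measures n = move_invariant_measures n"
proof -
  interpret group "free_group n" by (rule group_free_group)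
  have "(\<forall>g\<in>carrier (free_group n). \<forall>B\<in>sets \<mu>.
      emeasure \<mu> (conj_act n g -` B \<inter> space \<mu>) = emeasure \<mu> B) \<longleftrightarrow>
    (\<forall>g\<in>carrier (free_group n). \<forall>B\<in>sets \<mu>.
      emeasure \<mu> (move_root g -` B \<inter> space \<mu>) = emeasure \<mu> B)" (is "(\<forall>g\<in>_. ?C g) \<longleftrightarrow> (\<forall>g\<in>_. ?M g)")
    if "\<mu> \<in> prob_measures n" for \<mu>
  proof -
    have vimage: "conj_act n g -` B \<inter> space \<mu> = move_root (inv\<^bsub>free_group n\<^esub> g) -` B \<inter> space \<mu>"
      if "g \<in> carrier (free_group n)" for g B
      using conj_act_eq_move_root[OF _ that] prob_measuresD(2)[OF \<open>\<mu> \<in> prob_measures n\<close>] by auto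
    then have "?C g \<longleftrightarrow> ?M (inv\<^bsub>free_group n\<^esub> g)" if "g \<in> carrier (free_group n)" for g
      using that by simp
    then show ?thesis
      using inv_carrier inv_inv by metis
  qed
  then show ?thesis
    unfolding conjugation_invariant_measures_def move_invariant_measures_def by blast
qed

lemma unimodular_eq_move_invariant: "unimodular_measures n = move_invariant_measures n"
proof -
  let ?N = "borel_of (Lambda2_top n)"
  have "(\<forall>A\<in>sets ?N. mu_x \<mu> A = mu_y \<mu> A) \<longleftrightarrow>
      (\<forall>g\<in>carrier (free_group n). \<forall>B\<in>sets \<mu>. emeasure \<mu> (move_root g -` B \<inter> space \<mu>) = emeasure \<mu> B)"
    if \<mu>: "\<mu> \<in> prob_measures n" for \<mu>
  proof -
    note M = prob_measuresD[OF \<mu>]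
    have meas_cong: "measurable \<mu> ?N = measurable (borel_of (Lambda_top n)) ?N"
      "measurable ?N \<mu> = measurable ?N (borel_of (Lambda_top n))"
      by (rule measurable_cong_sets[OF M(1) refl], rule measurable_cong_sets[OF refl M(1)])
    interpret countable_cover \<mu> ?N "carrier (free_group n)" add_root move_root
      "\<lambda>g. move_root (inv\<^bsub>free_group n\<^esub> g)" pi_x pi_y
    proof
      show "carrier (free_group n) \<noteq> {}"
        using Nil_carrier by blast
      show "space ?N = (\<Union>g\<in>carrier (free_group n). add_root g ` space \<mu>)"
        by (simp add: M(2) Lambda2_eq_UN_add_root)
      show "pi_x \<in> measurable ?N \<mu>"
        unfolding meas_cong by (rule continuous_map_measurable_borel_of[OF continuous_map_pi_x])
    next
      fix g assume g: "g \<in> carrier (free_group n)"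
      show "add_root g \<in> measurable \<mu> ?N"
        unfolding meas_cong
        by (rule continuous_map_measurable_borel_of[OF continuous_map_add_root[OF carrier_letters[OF g]]])
      show "add_root g ` space \<mu> \<in> sets ?N"
        unfolding M(2) by (rule openin_sets_borel_of[OF openin_add_root_image[OF carrier_letters[OF g]]])
      show "move_root g \<in> measurable \<mu> \<mu>" "move_root (inv\<^bsub>free_group n\<^esub> g) \<in> measurable \<mu> \<mu>"
        by (rule move_root_measurable[OF \<mu>] g inv_carrier)+
      fix c assume "c \<in> space \<mu>"
      then have c: "c \<in> Lambda n"
        by (simp add: M(2))
      show "pi_x (add_root g c) = c" "pi_y (add_root g c) = move_root g c"
        using pi_add_root[OF c carrier_letters[OF g]] by simp_all
      show "move_root (inv\<^bsub>free_group n\<^esub> g) (move_root g c) = c"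
        "move_root g (move_root (inv\<^bsub>free_group n\<^esub> g) c) = c"
        using move_root_inv[OF c g] by simp_all
    qed (rule countable_free_group)
    have fiber: "(\<integral>\<^sup>+ d. m d \<partial>count_space {d \<in> A. P d}) = ecard {d \<in> A. P d}"
      if "A \<in> sets ?N" "\<And>d. d \<in> Lambda2 n \<Longrightarrow> m d = 1" for A P m
    proof -
      have "A \<subseteq> Lambda2 n"
        using sets.sets_into_space[OF that(1)] by simp
      then have "(\<integral>\<^sup>+ d. m d \<partial>count_space {d \<in> A. P d}) = (\<integral>\<^sup>+ d. 1 \<partial>count_space {d \<in> A. P d})"
        by (intro nn_integral_cong) (auto simp: that(2))
      then show ?thesis
        by (simp add: ecard_def emeasure_count_space)
    qed
    have "mu_x \<mu> A = (\<integral>\<^sup>+c. ecard {d \<in> A. pi_x d = c} \<partial>\<mu>)"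
      "mu_y \<mu> A = (\<integral>\<^sup>+c. ecard {d \<in> A. pi_y d = c} \<partial>\<mu>)" if "A \<in> sets ?N" for A
      unfolding mu_x_def mu_y_def by (simp_all only: fiber[OF that mass_eq_1(1)] fiber[OF that mass_eq_1(2)])
    then show ?thesis
      using counts_eq_iff_invariant by simp
  qed
  then show ?thesis
    unfolding unimodular_measures_def move_invariant_measures_def by blast
qed

text \<open>Two rooted graphs with isomorphic underlying graphs differ, up to isomorphism, by the position
  of the root, and connectedness provides an element that moves one root to the other.\<close>

lemma equiv_rel_eq_UN_graphs:
  "equiv_rel n = (\<Union>g\<in>carrier (free_group n). (\<lambda>c. (c, move_root g c)) ` Lambda n)"
proof (intro equalityI subsetI)
  fix e assume "e \<in> equiv_rel n"
  then obtain c d G x D y where e: "e = (c, d)" and c: "c \<in> Lambda n" "(G, x) \<in> c"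
    and d: "d \<in> Lambda n" "(D, y) \<in> d" and "isomorphic G D"
    by (auto simp: equiv_rel_def)
  then obtain f where f: "lgraph_iso f G D"
    by (auto simp: isomorphic_def)
  note G = rclass_of_member[OF c] and D = rclass_of_member[OF d]
  have fx: "f x \<in> verts D"
    using lgraph_iso_verts[OF f G(2)] .
  obtain g where g: "g \<in> carrier (free_group n)" "walk D (f x) g = y"
    using schreier_connected[OF D(1) fx D(2)] .
  have "c = rclass n (D, f x)"
    unfolding G(3) rclass_eq_iff[OF G(1,2) D(1) fx] using f by (auto simp: rooted_isomorphic_def)
  then have "move_root g c = d"
    using move_root_rclass[OF D(1) fx carrier_letters[OF g(1)]] g(2) D(3) by simp
  then show "e \<in> (\<Union>g\<in>carrier (free_group n). (\<lambda>c. (c, move_root g c)) ` Lambda n)"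
    using g(1) c(1) unfolding e by blast
next
  fix e assume "e \<in> (\<Union>g\<in>carrier (free_group n). (\<lambda>c. (c, move_root g c)) ` Lambda n)"
  then obtain g c where g: "g \<in> carrier (free_group n)" and c: "c \<in> Lambda n" and e: "e = (c, move_root g c)"
    by blast
  obtain G x where G: "schreier_graph n G" "x \<in> verts G" "c = rclass n (G, x)"
    using c by (rule LambdaE)
  have "(G, x) \<in> c" "(G, walk G x g) \<in> move_root g c"
    using G walk_carrier_verts[OF G(1,2) g] move_root_rclass[OF G(1,2) carrier_letters[OF g]]
    by (simp_all add: mem_rclass rooted_isomorphic_refl)
  moreover have "isomorphic G G"
    using lgraph_iso_id by (auto simp: isomorphic_def)
  ultimately show "e \<in> equiv_rel n"
    unfolding equiv_rel_def e using c move_root_Lambda[OF c carrier_letters[OF g]] by blast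
qed

lemma invariant_eq_move_invariant: "invariant_measures n = move_invariant_measures n"
proof -
  let ?E = "subtopology (prod_topology (Lambda_top n) (Lambda_top n)) (equiv_rel n)"
  let ?N = "borel_of ?E"
  have "equiv_rel n \<subseteq> Lambda n \<times> Lambda n"
    by (auto simp: equiv_rel_def)
  then have E: "topspace ?E = equiv_rel n"
    by auto
  have fst: "continuous_map ?E (Lambda_top n) fst" and snd: "continuous_map ?E (Lambda_top n) snd"
    by (auto intro: continuous_map_from_subtopology continuous_map_fst continuous_map_snd)
  have "(\<forall>A\<in>sets ?N. left_count \<mu> A = right_count \<mu> A) \<longleftrightarrow>
      (\<forall>g\<in>carrier (free_group n). \<forall>B\<in>sets \<mu>. emeasure \<mu> (move_root g -` B \<inter> space \<mu>) = emeasure \<mu> B)"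
    if \<mu>: "\<mu> \<in> prob_measures n" for \<mu>
  proof -
    note M = prob_measuresD[OF \<mu>]
    have meas_cong: "measurable \<mu> ?N = measurable (borel_of (Lambda_top n)) ?N"
      "measurable ?N \<mu> = measurable ?N (borel_of (Lambda_top n))"
      by (rule measurable_cong_sets[OF M(1) refl], rule measurable_cong_sets[OF refl M(1)])
    interpret countable_cover \<mu> ?N "carrier (free_group n)" "\<lambda>g c. (c, move_root g c)" move_root
      "\<lambda>g. move_root (inv\<^bsub>free_group n\<^esub> g)" fst snd
    proof
      show "carrier (free_group n) \<noteq> {}"
        using Nil_carrier by blast
      show "space ?N = (\<Union>g\<in>carrier (free_group n). (\<lambda>c. (c, move_root g c)) ` space \<mu>)"
        unfolding space_borel_of E M(2) by (rule equiv_rel_eq_UN_graphs)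
      show "fst \<in> measurable ?N \<mu>"
        unfolding meas_cong by (rule continuous_map_measurable_borel_of[OF fst])
    next
      fix g assume g: "g \<in> carrier (free_group n)"
      note move = continuous_map_move_root[OF carrier_letters[OF g]]
      have "continuous_map (Lambda_top n) ?E (\<lambda>c. (c, move_root g c))"
        using move g by (intro continuous_map_into_subtopology continuous_map_pairedI)
          (auto simp: equiv_rel_eq_UN_graphs)
      then show "(\<lambda>c. (c, move_root g c)) \<in> measurable \<mu> ?N"
        unfolding meas_cong by (rule continuous_map_measurable_borel_of)
      have "closedin ?E {e \<in> topspace ?E. (move_root g \<circ> fst) e = snd e}"
        by (rule closedin_continuous_maps_eq[OF Hausdorff_Lambda_top continuous_map_compose[OF fst move] snd])
      moreover have "{e \<in> topspace ?E. (move_root g \<circ> fst) e = snd e} = (\<lambda>c. (c, move_root g c)) ` space \<mu>"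
        unfolding E M(2) using g by (auto simp: equiv_rel_eq_UN_graphs)
      ultimately show "(\<lambda>c. (c, move_root g c)) ` space \<mu> \<in> sets ?N"
        by (simp only: closedin_sets_borel_of)
      show "move_root g \<in> measurable \<mu> \<mu>" "move_root (inv\<^bsub>free_group n\<^esub> g) \<in> measurable \<mu> \<mu>"
        by (rule move_root_measurable[OF \<mu>] g inv_carrier)+
      fix c assume "c \<in> space \<mu>"
      then have c: "c \<in> Lambda n"
        by (simp add: M(2))
      show "move_root (inv\<^bsub>free_group n\<^esub> g) (move_root g c) = c"
        "move_root g (move_root (inv\<^bsub>free_group n\<^esub> g) c) = c"
        using move_root_inv[OF c g] by simp_all
    qed (simp_all add: countable_free_group)
    show ?thesis
      unfolding left_count_def right_count_def by (rule counts_eq_iff_invariant)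
  qed
  then show ?thesis
    unfolding invariant_measures_def move_invariant_measures_def equiv_rel_borel_def by blast
qed

theorem theorem5p2:
  fixes n :: nat
  shows "invariant_measures n = unimodular_measures n \<and>
         unimodular_measures n = conjugation_invariant_measures n"
  by (simp add: invariant_eq_move_invariant unimodular_eq_move_invariant
      conjugation_invariant_eq_move_invariant)

end
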